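(* For an irrational point $(a,b)\in\Omega$ (i.e. $b/a\notin\mathbb{Q}$) and $n\ge1$, let $$\hat f_n=\sum_{i=1}^n\left(\hat k(T^{i-1}(a,b))-3\right),\qquad \hat f_{-n}=\sum_{i=0}^n\left(\hat k(T^{-i-1}(a,b))-3\right),$$ where $\hat k=\frac{k+k^T}{2}$. Then: (1) For every irrational point $(a,b)\in\Omega$, with $e^+=e^+(b/a)$ and $e^-=e^-(b/a)$ the even and odd Diophantine exponents of $b/a$, $$\limsup_{n\rightarrow+\infty}\frac{\log|\hat f_n|}{\log n}=\max\left\{\frac{e^--1}{e^-},\frac{e^+-2}{e^+}\right\}.$$ (2) For every irrational point $(a,b)\in\Omega$, with the same notation, $$\limsup_{n\rightarrow+\infty}\frac{\log|\hat f_{-n}|}{\log n}=\max\left\{\frac{e^+-1}{e^+},\frac{e^--2}{e^-}\right\}.$$ (3) For almost every (with respect to Lebesgue measure) irrational point $(a,b)\in\Omega$, one has $e(b/a)=e^+(b/a)=e^-(b/a)=2$ and $$\limsup_{n\rightarrow+\infty}\frac{\log|\hat f_n|}{\log n}=\limsup_{n\rightarrow+\infty}\frac{\log|\hat f_{-n}|}{\log n}=\frac12.$$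
   Context: The BCZ triangle (Farey triangle) is $\Omega=\{(a,b)\in\mathbb{R}^2 : a,b\in(0,1],\ a+b>1\}$. With $[x]$ denoting the integer part (floor) of $x$, the itinerary function is $k(a,b)=\left[\frac{1+a}{b}\right]$ and the BCZ map $T:\Omega\to\Omega$ is the bijection $T(a,b)=\left(b,-a+\left[\frac{1+a}{b}\right]b\right)$. Define $k^T(a,b)=k(T^{-1}(a,b))=k(b,a)$ and $\hat k=\frac{k+k^T}{2}$. For an irrational number $s$ (with $p/q$ in lowest terms, $q\ge1$, below): the Diophantine exponent $e(s)$ is the supremum of all $v\in\mathbb{R}$ such that $\left|s-\frac pq\right|<\frac1{q^v}$ has infinitely many solutions $\frac pq\in\mathbb{Q}$; the even Diophantine exponent $e^+(s)$ is the supremum of all $v\in\mathbb{R}$ such that $0<\frac pq-s<\frac1{q^v}$ has infinitely many solutions $\frac pq\in\mathbb{Q}$; the odd Diophantine exponent $e^-(s)$ is the supremum of all $v\in\mathbb{R}$ such that $0<s-\frac pq<\frac1{q^v}$ has infinitely many solutions $\frac pq\in\mathbb{Q}$. These are elements of $[2,+\infty]$; if an exponent $e^{\pm}$ is $+\infty$, the fractions $\frac{e^\pm-1}{e^\pm}$ and $\frac{e^\pm-2}{e^\pm}$ are read as $1$. Also $\log 0=-\infty$. *)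

theory Defs
  imports "HOL-Analysis.Analysis"
begin

definition farey_triangle :: "(real \<times> real) set" where
  "farey_triangle = {(a, b). a \<in> {0<..1} \<and> b \<in> {0<..1} \<and> a + b > 1}"

definition itinerary :: "real \<times> real \<Rightarrow> int" where
  "itinerary = (\<lambda>(a, b). \<lfloor>(1 + a) / b\<rfloor>)"

definition bcz :: "real \<times> real \<Rightarrow> real \<times> real" where
  "bcz = (\<lambda>(a, b). (b, - a + of_int \<lfloor>(1 + a) / b\<rfloor> * b))"

text \<open>The inverse is meaningful on the Farey triangle only; it is the two-sided inverse there by
  \<open>bcz_bij\<close> below.\<close>

definition bcz_inv :: "real \<times> real \<Rightarrow> real \<times> real" where
  "bcz_inv = inv_into farey_triangle bcz"

definition itinerary_T :: "real \<times> real \<Rightarrow> int" where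
  "itinerary_T p = itinerary (bcz_inv p)"

definition itinerary_hat :: "real \<times> real \<Rightarrow> real" where
  "itinerary_hat p = (of_int (itinerary p) + of_int (itinerary_T p)) / 2"

definition f_hat :: "real \<times> real \<Rightarrow> nat \<Rightarrow> real" where
  "f_hat p n = (\<Sum>i=1..n. itinerary_hat ((bcz ^^ (i - 1)) p) - 3)"

text \<open>\<open>f_hat_neg p n\<close> is the sum with index \<open>-n\<close>; it has \<open>n + 1\<close> terms.\<close>

definition f_hat_neg :: "real \<times> real \<Rightarrow> nat \<Rightarrow> real" where
  "f_hat_neg p n = (\<Sum>i=0..n. itinerary_hat ((bcz_inv ^^ (i + 1)) p) - 3)"

text \<open>The denominator of a rational number in lowest terms, positive by convention.\<close>

definition denom :: "rat \<Rightarrow> int" where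
  "denom r = snd (quotient_of r)"

definition dioph_exp :: "real \<Rightarrow> ereal" where
  "dioph_exp s = Sup {ereal v | v :: real.
     infinite {r :: rat. \<bar>s - of_rat r\<bar> < 1 / of_int (denom r) powr v}}"

definition dioph_exp_even :: "real \<Rightarrow> ereal" where
  "dioph_exp_even s = Sup {ereal v | v :: real.
     infinite {r :: rat. 0 < of_rat r - s \<and> of_rat r - s < 1 / of_int (denom r) powr v}}"

definition dioph_exp_odd :: "real \<Rightarrow> ereal" where
  "dioph_exp_odd s = Sup {ereal v | v :: real.
     infinite {r :: rat. 0 < s - of_rat r \<and> s - of_rat r < 1 / of_int (denom r) powr v}}"

text \<open>The fraction \<open>(e - c) / e\<close>, read as \<open>1\<close> for infinite \<open>e\<close>
  (where \<open>ereal\<close> division would return \<open>0\<close> times infinity, that is \<open>0\<close>).\<close>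

definition exp_frac :: "ereal \<Rightarrow> ereal \<Rightarrow> ereal" where
  "exp_frac c e = (if e = \<infinity> then 1 else (e - c) / e)"

text \<open>The logarithm of a nonnegative real with \<open>log 0 = -\<infinity>\<close>, whereas \<open>ln 0 = 0\<close> in the library.\<close>

definition elog :: "real \<Rightarrow> ereal" where
  "elog x = (if x = 0 then - \<infinity> else ereal (ln x))"

text \<open>The upper growth exponent; the term at index \<open>1\<close> divides by \<open>log 1 = 0\<close>, which is
  irrelevant for the limit superior.\<close>

definition growth_exp :: "(nat \<Rightarrow> real) \<Rightarrow> ereal" where
  "growth_exp x = limsup (\<lambda>n. elog \<bar>x n\<bar> / elog (real n))"

lemma bcz_left_inverse:
  assumes "(a, b) \<in> farey_triangle" and "bcz (a, b) = (x, y)"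
  shows "(x, y) \<in> farey_triangle" and "a = - y + of_int \<lfloor>(1 + y) / x\<rfloor> * x" and "b = x"
    and "\<lfloor>(1 + y) / x\<rfloor> = \<lfloor>(1 + a) / b\<rfloor>"
proof -
  define m where "m = \<lfloor>(1 + a) / b\<rfloor>"
  have ab: "0 < a" "a \<le> 1" "0 < b" "b \<le> 1" "a + b > 1"
    using assms(1) by (auto simp: farey_triangle_def)
  have xy: "x = b" "y = - a + of_int m * b"
    using assms(2) by (auto simp: bcz_def m_def)
  have "of_int m \<le> (1 + a) / b" "(1 + a) / b < of_int m + 1"
    unfolding m_def by linarith+
  then have m: "of_int m * b \<le> 1 + a" "1 + a < (of_int m + 1) * b"
    using ab by (simp_all add: field_simps)
  then have y: "y \<le> 1" "x + y > 1"
    by (simp_all add: xy algebra_simps)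
  show "(x, y) \<in> farey_triangle"
    using ab y xy by (auto simp: farey_triangle_def)
  have "\<lfloor>(1 + y) / x\<rfloor> = m"
    using ab xy by (intro floor_unique) (simp_all add: field_simps)
  then show "\<lfloor>(1 + y) / x\<rfloor> = \<lfloor>(1 + a) / b\<rfloor>"
    and "a = - y + of_int \<lfloor>(1 + y) / x\<rfloor> * x"
    unfolding m_def[symmetric] by (simp_all only: xy)
  show "b = x" using xy by simp
qed

lemma bcz_bij: "bij_betw bcz farey_triangle farey_triangle"
proof -
  have swap: "(b, a) \<in> farey_triangle \<longleftrightarrow> (a, b) \<in> farey_triangle" for a b
    by (auto simp: farey_triangle_def)
  have closed: "bcz p \<in> farey_triangle" if "p \<in> farey_triangle" for p
    using that bcz_left_inverse(1)[of "fst p" "snd p" "fst (bcz p)" "snd (bcz p)"]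
    by (simp only: prod.collapse)
  have rev: "bcz (snd (bcz (a, b)), fst (bcz (a, b))) = (b, a)" if "(a, b) \<in> farey_triangle" for a b
  proof -
    obtain x y where xy: "bcz (a, b) = (x, y)" by fastforce
    show ?thesis
    proof -
      have "bcz (y, x) = (x, - y + of_int \<lfloor>(1 + y) / x\<rfloor> * x)"
        by (simp only: bcz_def prod.case)
      also have "\<dots> = (b, a)"
        by (rule arg_cong2[of _ _ _ _ Pair])
          (rule bcz_left_inverse(3)[OF that xy, symmetric],
           rule bcz_left_inverse(2)[OF that xy, symmetric])
      finally show ?thesis by (simp only: xy fst_conv snd_conv)
    qed
  qed
  have "inj_on bcz farey_triangle"
  proof (rule inj_onI)
    fix p q
    assume p: "p \<in> farey_triangle" and q: "q \<in> farey_triangle" and eq: "bcz p = bcz q"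
    have "prod.swap p = prod.swap q"
      using rev[of "fst p" "snd p"] rev[of "fst q" "snd q"] p q eq
      by (simp only: prod.collapse prod.swap_def)
    then show "p = q" by (simp only: swap_swap prod.inject prod.swap_def prod_eq_iff fst_conv snd_conv)
  qed
  moreover have "p \<in> bcz ` farey_triangle" if p: "p \<in> farey_triangle" for p
  proof -
    obtain a b where ab: "p = (a, b)" by fastforce
    obtain x y where xy: "bcz (b, a) = (x, y)" by fastforce
    have ba: "(b, a) \<in> farey_triangle" using p swap[of b a] unfolding ab by blast
    have "(y, x) \<in> farey_triangle" using closed[OF ba] swap[of x y] unfolding xy by blast
    moreover have "bcz (y, x) = p" using rev[OF ba] unfolding xy ab by (simp only: fst_conv snd_conv)
    ultimately show ?thesis by (rule rev_image_eqI[OF _ sym])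
  qed
  ultimately show ?thesis
    using closed by (intro bij_betw_imageI equalityI image_subsetI subsetI)
qed

lemma itinerary_T_eq:
  assumes "(a, b) \<in> farey_triangle"
  shows "itinerary_T (a, b) = itinerary (b, a)"
proof -
  obtain c d where cd: "bcz_inv (a, b) = (c, d)" by fastforce
  have "(c, d) \<in> farey_triangle" "bcz (c, d) = (a, b)"
    unfolding cd[symmetric] unfolding bcz_inv_def
    by (rule bij_betw_apply[OF bij_betw_inv_into[OF bcz_bij] assms],
        rule bij_betw_inv_into_right[OF bcz_bij assms])
  from bcz_left_inverse(4)[OF this] show ?thesis
    by (simp add: itinerary_T_def cd itinerary_def)
qed

end

theory Submission
  imports Defs "HOL-Real_Asymp.Real_Asymp"
begin

text \<open>
  The coordinates along the orbit of \<open>(a, b)\<close> are the values \<open>Q b - P a \<in> (0, 1]\<close> at the fractions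
  \<open>P / Q\<close> below \<open>s = b / a\<close>, in increasing order of \<open>P / Q\<close>. Consecutive fractions bound an interval of the
  Stern--Brocot tree, which is addressed by a word in two letters \<open>A\<close> and \<open>B\<close>. The step of the map with
  itinerary \<open>k\<close> replaces a final segment \<open>A B\<^sup>j\<close> of the address by \<open>B A\<^bsup>k-j-1\<^esup>\<close>, so the height
  \<open>#A - #B\<close> changes by \<open>k - 3\<close>, and the sums of the corollary are, up to a constant, means of two consecutive
  heights.

  Upper bound: the height is at most the length of the address, which is at most its longest run times a
  logarithm. A run of length \<open>j\<close> turns around a fraction with some denominator \<open>Q\<close>. With
  \<open>t = q\<^sub>n / y\<^sub>n\<close>, one finds \<open>j \<lesssim> min (Q\<^bsup>e-1\<^esup>, t / Q)\<close> for lower and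
  \<open>j \<lesssim> min (Q\<^bsup>e-2\<^esup>, t / Q\<^sup>2)\<close> for upper fractions, which gives the two exponents in terms of \<open>t\<close>.
  Finally \<open>t \<le> n\<^bsup>1+o(1)\<^esup>\<close>, because \<open>t\<close> is a sum of return times, each bounded by digits.

  Lower bound: at a good lower fraction a single digit is as large as claimed. Near a good upper fraction the
  address contains a long run of \<open>B\<close>, and the heights at its two ends differ by its length up to
  \<open>O(Q)\<close>; this suffices because the second exponent is only relevant if it exceeds \<open>1 / 2\<close>, that is
  \<open>e\<^sup>+ > 4\<close>.

  Backward sums are forward sums for \<open>(b, a)\<close>, which exchanges the two exponents; almost everywhere both are
  \<open>2\<close> by Borel--Cantelli and Fubini.
\<close>

section \<open>Words in the Stern--Brocot tree\<close>

text \<open>A linear form with value \<open>c\<close> at \<open>(1, 0)\<close> and \<open>d\<close> at \<open>(0, 1)\<close> is evaluated at the left and right end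
  of the Stern--Brocot interval addressed by a word. \<open>True\<close> stands for \<open>A\<close> (left half), \<open>False\<close> for
  \<open>B\<close> (right half), and the head of the list is the last letter. The vector \<open>(Q, P)\<close> represents
  \<open>P / Q\<close>.\<close>

fun left_val right_val :: "'a::comm_ring_1 \<Rightarrow> 'a \<Rightarrow> bool list \<Rightarrow> 'a" where
  "left_val c d [] = c"
| "left_val c d (x # w) = (if x then left_val c d w else left_val c d w + right_val c d w)"
| "right_val c d [] = d"
| "right_val c d (x # w) = (if x then left_val c d w + right_val c d w else right_val c d w)"

text \<open>The head of a list is its last letter, so \<open>X\<close> is read first and its two
  values are the initial data for \<open>Y\<close>.\<close>

lemma val_append:
  "left_val c d (Y @ X) = left_val (left_val c d X) (right_val c d X) Y"
  "right_val c d (Y @ X) = right_val (left_val c d X) (right_val c d X) Y"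
  by (induction Y) auto

text \<open>Reduces every form to the denominators (form \<open>1 0\<close>) and numerators (form
  \<open>0 1\<close>) of the two ends.\<close>

lemma val_linear:
  "left_val c d w = c * left_val 1 0 w + d * left_val 0 1 w"
  "right_val c d w = c * right_val 1 0 w + d * right_val 0 1 w"
  by (induction w) (auto simp: algebra_simps)

lemma val_replicate:
  "left_val c d (replicate j True) = c"
  "right_val c d (replicate j True) = d + of_nat j * c"
  "left_val c d (replicate j False) = c + of_nat j * d"
  "right_val c d (replicate j False) = d"
  by (induction j) (auto simp: algebra_simps)

text \<open>Each letter adds one end to the other, a column operation, so the determinant keeps its
  value at the empty word.\<close>

lemma val_det:
  "left_val c d w * right_val c' d' w - right_val c d w * left_val c' d' w = c * d' - d * c'"
  by (induction w) (auto simp: algebra_simps)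

lemma val_of_int:
  "left_val (of_int c) (of_int d) w = (of_int (left_val c d w) :: 'a::comm_ring_1)"
  "right_val (of_int c) (of_int d) w = (of_int (right_val c d w) :: 'a)"
  by (induction w) auto

lemma val_nonneg:
  fixes c d :: "'a::linordered_idom"
  assumes "c \<ge> 0" "d \<ge> 0"
  shows "left_val c d w \<ge> c" "right_val c d w \<ge> d"
proof -
  have "left_val c d w \<ge> c \<and> right_val c d w \<ge> d"
    using assms by (induction w) (auto intro: add_increasing add_increasing2 order_trans)
  then show "left_val c d w \<ge> c" "right_val c d w \<ge> d" by auto
qed

definition height :: "bool list \<Rightarrow> int" where
  "height w = int (count_list w True) - int (count_list w False)"

lemma height_simps [simp]:
  "height [] = 0" "height (x # w) = height w + (if x then 1 else - 1)"
  "height (v @ w) = height v + height w"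
  "height (replicate j True) = int j" "height (replicate j False) = - int j"
proof -
  show "height [] = 0" "height (x # w) = height w + (if x then 1 else - 1)"
    "height (v @ w) = height v + height w"
    by (auto simp: height_def)
  show "height (replicate j True) = int j" "height (replicate j False) = - int j"
    by (induction j) (auto simp: height_def)
qed

lemma count_list_replicate: "count_list (replicate j x) y = (if x = y then j else 0)"
  by (induction j) auto

lemma abs_height_le: "\<bar>height w\<bar> \<le> int (length w)"
  by (induction w) auto

text \<open>The rewriting that passes from one leaf of the Stern--Brocot tree to the next.\<close>

lemma word_step:
  fixes c d :: "'a::comm_ring_1"
  assumes w: "w = replicate j False @ True # X" and w': "w' = replicate i True @ False # X"
    and k: "k = int i + int j + 1"
  shows "left_val c d w' = right_val c d w" "right_val c d w' = of_int k * right_val c d w - left_val c d w"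
    "height w' = height w + k - 3" "count_list w' False + j = count_list w False + 1"
  by (auto simp: w w' k val_append val_replicate algebra_simps count_list_replicate)

text \<open>The last letter can be read off: after \<open>True\<close> the right vector exceeds the
  left one by a nonzero nonnegative vector, after \<open>False\<close> it is the other way round.
  Induction peels off the letters.\<close>

lemma word_inject:
  assumes "left_val (1::int) 0 v = left_val 1 0 w" "right_val (1::int) 0 v = right_val 1 0 w"
    "left_val (0::int) 1 v = left_val 0 1 w" "right_val (0::int) 1 v = right_val 0 1 w"
  shows "v = w"
  using assms
proof (induction v arbitrary: w)
  case Nil
  show ?case
  proof (cases w)
    case (Cons x u)
    then show ?thesis
      using Nil val_nonneg[of "1::int" 0 u] val_nonneg[of "0::int" 1 u] by (cases x) auto
  qed simp
next
  case (Cons x v)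
  note pos = val_nonneg[of "1::int" 0 v] val_nonneg[of "0::int" 1 v]
  show ?case
  proof (cases w)
    case Nil
    then show ?thesis using Cons pos by (cases x) auto
  next
    case (Cons z u)
    note pos' = val_nonneg[of "1::int" 0 u] val_nonneg[of "0::int" 1 u]
    show ?thesis
    proof (cases "x = z")
      case True
      then show ?thesis
        using Cons.IH[of u] Cons.prems unfolding Cons by (cases z) auto
    next
      case False
      then show ?thesis
        using Cons.prems pos pos' unfolding Cons by (cases x; cases z) auto
    qed
  qed
qed

text \<open>Subtractive Euclidean algorithm on a matrix of determinant 1: while one column dominates
  the other, subtract it and record the letter; otherwise the matrix is the identity.\<close>

lemma word_exists:
  fixes q p q' p' :: int
  assumes "q * p' - p * q' = 1" "q \<ge> 0" "p \<ge> 0" "q' \<ge> 0" "p' \<ge> 0"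
  shows "\<exists>w. left_val 1 0 w = q \<and> right_val 1 0 w = q' \<and> left_val 0 1 w = p \<and> right_val 0 1 w = p'"
  using assms
proof (induction "nat (q + p + q' + p')" arbitrary: q p q' p' rule: less_induct)
  case less
  have "q > 0 \<or> p > 0" "q' > 0 \<or> p' > 0"
  proof -
    have "\<not> (q = 0 \<and> p = 0)" "\<not> (q' = 0 \<and> p' = 0)" using less.prems(1) by auto
    then show "q > 0 \<or> p > 0" "q' > 0 \<or> p' > 0" using less.prems by linarith+
  qed
  then consider "q' \<ge> q" "p' \<ge> p" "q > 0 \<or> p > 0" | "q \<ge> q'" "p \<ge> p'" "q' > 0 \<or> p' > 0" | "q' < q" "p' > p"
    | "q' > q" "p' < p" by linarith
  then show ?case
  proof cases
    case 1
    obtain w where "left_val 1 0 w = q \<and> right_val 1 0 w = q' - q \<and> left_val 0 1 w = p \<and> right_val 0 1 w = p' - p"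
      using less.hyps[of q p "q' - q" "p' - p"] less.prems 1 by (force simp: algebra_simps)
    then show ?thesis by (intro exI[of _ "True # w"]) auto
  next
    case 2
    obtain w where "left_val 1 0 w = q - q' \<and> right_val 1 0 w = q' \<and> left_val 0 1 w = p - p' \<and> right_val 0 1 w = p'"
      using less.hyps[of "q - q'" "p - p'" q' p'] less.prems 2 by (force simp: algebra_simps)
    then show ?thesis by (intro exI[of _ "False # w"]) auto
  next
    case 3
    \<comment> \<open>The determinant is therefore at least \<open>q' + p + 1\<close>; as it is 1,
      both off-diagonal entries vanish.\<close>
    have "q * p' \<ge> (q' + 1) * (p + 1)" using 3 less.prems by (intro mult_mono) auto
    then have "q' = 0 \<and> p = 0" using less.prems by (auto simp: algebra_simps) 
    then have "q = 1 \<and> p' = 1" using less.prems by (simp add: pos_zmult_eq_1_iff_lemma zmult_eq_1_iff)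
    then show ?thesis using \<open>q' = 0 \<and> p = 0\<close> by (intro exI[of _ "[]"]) auto
  next
    case 4
    have "q' * p \<ge> q * p'" using 4 less.prems by (intro mult_mono) auto
    then show ?thesis using less.prems by (auto simp: algebra_simps)
  qed
qed

section \<open>Length of a word in terms of its longest run\<close>

lemma val_letter:
  "True \<in> set w \<Longrightarrow> right_val (1::int) 0 w \<ge> 1" "False \<in> set w \<Longrightarrow> left_val (0::int) 1 w \<ge> 1"
proof (induction w)
  case (Cons x w)
  { case 1 then show ?case
      using Cons val_nonneg[of "1::int" 0 w] by (auto split: if_splits) }
  { case 2 then show ?case
      using Cons val_nonneg[of "0::int" 1 w] by (auto split: if_splits) }
qed auto

text \<open>A block of \<open>K + 1\<close> letters contains both letters, so all four entries of
  its matrix are at least 1 and the sum of the two values of the form \<open>1 1\<close> at least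
  doubles with each block.\<close>

lemma runs_imp_doubling:
  assumes "\<And>Z j x X. w = Z @ replicate j x @ X \<Longrightarrow> j \<le> K" "length w \<ge> m * (K + 1)"
  shows "left_val (1::int) 1 w + right_val 1 1 w \<ge> 2 ^ m"
  using assms
proof (induction m arbitrary: w)
  case 0
  then show ?case using val_nonneg[of "1::int" 1 w] by simp
next
  case (Suc m)
  define u v where "u = take (K + 1) w" and "v = drop (K + 1) w"
  have w: "w = u @ v" and len: "length u = K + 1" "length v \<ge> m * (K + 1)"
    using Suc.prems(2) by (auto simp: u_def v_def)
  have IH: "2 ^ m \<le> left_val (1::int) 1 v + right_val 1 1 v"
  proof (rule Suc.IH)
    fix Z j x X assume "v = Z @ replicate j x @ X"
    then show "j \<le> K" using Suc.prems(1)[of "u @ Z" j x X] w by simp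
  qed (use len in simp)
  have "x \<in> set u" for x
  proof (rule ccontr)
    assume "x \<notin> set u"
    then have "y = (\<not> x)" if "y \<in> set u" for y using that by (cases "y = x") auto
    then have "u = replicate (K + 1) (\<not> x)"
      using len by (intro replicate_eqI)
    then show False using Suc.prems(1)[of "[]" "K + 1" "\<not> x" v] w by simp
  qed
  then have b: "right_val (1::int) 0 u \<ge> 1" "left_val (0::int) 1 u \<ge> 1"
    using val_letter[of u] by auto
  define l r where "l = left_val (1::int) 1 v" and "r = right_val (1::int) 1 v"
  have lr: "l \<ge> 0" "r \<ge> 0" using val_nonneg[of "1::int" 1 v] by (auto simp: l_def r_def)
  have *: "left_val l r u + right_val l r u = l * (left_val 1 0 u + right_val 1 0 u) + r * (left_val 0 1 u + right_val 0 1 u)"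
    using val_linear[of l r u] by (simp add: algebra_simps)
  have "l * 2 + r * 2 \<le> l * (left_val 1 0 u + right_val 1 0 u) + r * (left_val 0 1 u + right_val 0 1 u)"
    using b lr val_nonneg[of "1::int" 0 u] val_nonneg[of "0::int" 1 u]
    by (intro add_mono mult_left_mono) auto
  with IH show ?case by (simp add: w val_append * flip: l_def r_def)
qed

text \<open>Solves the doubling estimate for the length; the summand 1 next to the logarithm pays
  for an incomplete block.\<close>

lemma length_le_of_runs:
  assumes "\<And>Z j x X. w = Z @ replicate j x @ X \<Longrightarrow> real j \<le> K"
  shows "real (length w) \<le> (K + 1) * (log 2 (left_val 1 1 w + right_val 1 1 w) + 1)"
proof -
  define k m where "k = nat \<lfloor>K\<rfloor>" and "m = length w div (k + 1)"
  have K: "K \<ge> 0" using assms[of "[]" 0 True w] by simp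
  have le: "j \<le> k" if "w = Z @ replicate j x @ X" for Z j x X
    using assms[OF that] unfolding k_def by linarith
  have "2 ^ m \<le> left_val (1::int) 1 w + right_val 1 1 w"
    by (rule runs_imp_doubling[OF le]) (simp_all only: m_def div_times_less_eq_dividend)
  then have "real_of_int (2 ^ m) \<le> real_of_int (left_val (1::int) 1 w + right_val 1 1 w)"
    by (simp only: of_int_le_iff)
  then have "2 ^ m \<le> left_val (1::real) 1 w + right_val 1 1 w"
    using val_of_int[of 1 1 w, where 'a = real] by simp
  then have "real m \<le> log 2 (left_val 1 1 w + right_val 1 1 w)"
    by (intro le_log_of_power) auto
  moreover have "length w < (m + 1) * (k + 1)"
    unfolding m_def using dividend_less_div_times[of "k + 1" "length w"] by (simp add: algebra_simps)
  then have "real (length w) < real ((m + 1) * (k + 1))"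
    by (simp only: of_nat_less_iff)
  then have "real (length w) \<le> (real m + 1) * (real k + 1)"
    by (simp add: algebra_simps)
  moreover have "\<dots> \<le> (log 2 (left_val 1 1 w + right_val 1 1 w) + 1) * (K + 1)"
    using calculation(1) K by (intro mult_mono) (auto simp: k_def)
  ultimately show ?thesis by (simp add: mult.commute)
qed

section \<open>The orbit as a sequence of leaves\<close>

text \<open>Along an orbit \<open>k\<close> exceeds the length of the leading run of \<open>B\<close>, so the subtraction does not
  truncate.\<close>

definition next_word :: "int \<Rightarrow> bool list \<Rightarrow> bool list" where
  "next_word k w = replicate (nat k - length (takeWhile Not w) - 1) True
     @ False # tl (dropWhile Not w)"

lemma leading_run:
  assumes "True \<in> set w"
  shows "w = replicate (length (takeWhile Not w)) False @ True # tl (dropWhile Not w)"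
proof -
  have "dropWhile Not w \<noteq> []" using assms by (metis (full_types) dropWhile_eq_Nil_conv)
  then have "dropWhile Not w = True # tl (dropWhile Not w)"
    using hd_dropWhile[of Not w] by (cases "dropWhile Not w") auto
  moreover have "takeWhile Not w = replicate (length (takeWhile Not w)) False"
    by (intro replicate_eqI) (auto dest: set_takeWhileD)
  ultimately show ?thesis by (metis takeWhile_dropWhile_id)
qed

lemma farey_triangle_bcz: "p \<in> farey_triangle \<Longrightarrow> bcz p \<in> farey_triangle"
  using bcz_bij by (rule bij_betw_apply)

locale bcz_orbit =
  fixes a b :: real
  assumes start: "(a, b) \<in> farey_triangle" and irrational: "b / a \<notin> \<rat>"
begin

text \<open>The index is shifted: \<open>y 0 = b\<close> belongs to the fraction \<open>0 / 1\<close>, and \<open>a\<close>, which belongs to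
  \<open>-1 / 0\<close>, is left out.\<close>

definition y :: "nat \<Rightarrow> real" where "y n = snd ((bcz ^^ n) (a, b))"

definition K :: "nat \<Rightarrow> int" where "K n = itinerary ((bcz ^^ n) (a, b))"

text \<open>The first interval runs from \<open>0 / 1\<close> to \<open>1 / K 0\<close>; the form
  takes the values \<open>b\<close> and \<open>K 0 * b - a\<close> there, the first two terms of
  \<open>y\<close>.\<close>

primrec word :: "nat \<Rightarrow> bool list" where
  "word 0 = replicate (nat (K 0)) True"
| "word (Suc n) = next_word (K (Suc n)) (word n)"

declare word.simps(2) [simp del]

definition q :: "nat \<Rightarrow> int" where "q n = left_val 1 0 (word n)"

definition p :: "nat \<Rightarrow> int" where "p n = left_val 0 1 (word n)"

text \<open>An accumulated time: by \<open>t_Suc\<close> its increments are \<open>a\<close> times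
  the return times \<open>1 / (y n * y (Suc n))\<close>.\<close>

definition t :: "nat \<Rightarrow> real" where "t n = q n / y n"

lemma ab: "0 < a" "a \<le> 1" "0 < b" "b \<le> 1" "a + b > 1"
  using start by (auto simp: farey_triangle_def)

lemma orbit_in: "(bcz ^^ n) (a, b) \<in> farey_triangle"
  by (induction n) (auto simp: start farey_triangle_bcz)

lemma y_0: "y 0 = b"
  by (simp add: y_def)

lemma orbit_Suc: "(bcz ^^ Suc n) (a, b) = (y n, y (Suc n))"
  by (simp add: y_def bcz_def split: prod.splits)

lemma y_bounds: "0 < y n" "y n \<le> 1" "y n + y (Suc n) > 1"
proof -
  show "0 < y n" "y n \<le> 1"
    using orbit_in[of n] by (auto simp: y_def farey_triangle_def split: prod.splits)
  show "y n + y (Suc n) > 1"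
    using orbit_in[of "Suc n"] unfolding orbit_Suc by (auto simp: farey_triangle_def)
qed

lemma K_0: "K 0 = \<lfloor>(1 + a) / b\<rfloor>"
  by (simp add: K_def itinerary_def)

lemma K_Suc: "K (Suc n) = \<lfloor>(1 + y n) / y (Suc n)\<rfloor>"
  unfolding K_def orbit_Suc by (simp add: itinerary_def)

lemma y_Suc_0: "y (Suc 0) = K 0 * b - a"
  by (simp add: y_def K_def bcz_def itinerary_def)

lemma y_Suc_Suc: "y (Suc (Suc n)) = K (Suc n) * y (Suc n) - y n"
proof -
  have "y (Suc (Suc n)) = snd (bcz ((bcz ^^ Suc n) (a, b)))" by (simp add: y_def)
  also have "\<dots> = K (Suc n) * y (Suc n) - y n"
    unfolding orbit_Suc by (simp add: bcz_def K_Suc)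
  finally show ?thesis .
qed

text \<open>The coordinate \<open>z\<close> preceding \<open>y n\<close> in the orbit lies in
  \<open>(0, 1]\<close>, which makes the digit comparable to \<open>1 / y n\<close>.\<close>

lemma K_bounds: "K n \<ge> 1" "1 / y n < K n + 1" "K n \<le> 2 / y n"
proof -
  have "\<exists>z. 0 < z \<and> z \<le> 1 \<and> K n = \<lfloor>(1 + z) / y n\<rfloor>"
  proof (cases n)
    case 0
    then show ?thesis using ab K_0 by (intro exI[of _ a]) (simp add: y_0)
  next
    case (Suc m)
    then show ?thesis using y_bounds K_Suc by (intro exI[of _ "y m"]) simp
  qed
  then obtain z where z: "0 < z" "z \<le> 1" "K n = \<lfloor>(1 + z) / y n\<rfloor>" by blast
  have "1 / y n < (1 + z) / y n" "(1 + z) / y n \<le> 2 / y n"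
    using z y_bounds[of n] by (auto intro: divide_right_mono divide_strict_right_mono)
  moreover have "1 / y n \<ge> 1" using y_bounds[of n] by simp
  ultimately show "K n \<ge> 1" "1 / y n < K n + 1" "K n \<le> 2 / y n"
    unfolding z(3) by linarith+
qed

text \<open>If the right vector were below and the left one above the line of slope \<open>b / a\<close>, the
  determinant of the pair would have the wrong sign.\<close>

lemma left_val_pos_suffix: "left_val b (- a) (Y @ X) > 0 \<Longrightarrow> left_val b (- a) X > 0"
proof (induction Y)
  case (Cons c Y)
  define l r where "l = left_val b (- a) (Y @ X)" and "r = right_val b (- a) (Y @ X)"
  have "l > 0"
  proof (rule ccontr)
    assume "\<not> l > 0"
    moreover from this have "r > 0" using Cons.prems by (auto simp: l_def r_def split: if_splits)
    ultimately have "left_val 1 0 (Y @ X) * r \<ge> 0" "right_val 1 0 (Y @ X) * l \<le> 0"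
      using val_nonneg[of "1::real" 0 "Y @ X"]
      by (auto intro!: mult_nonneg_nonneg mult_nonneg_nonpos)
    then have "left_val 1 0 (Y @ X) * r - right_val 1 0 (Y @ X) * l \<ge> 0" by linarith
    then show False
      using val_det[of 1 0 "Y @ X" b "- a"] ab by (simp add: l_def r_def)
  qed
  then show ?case using Cons.IH by (simp add: l_def)
qed simp

text \<open>One induction serves both claims: the values at \<open>word n\<close> show that
  \<open>next_word\<close> does not truncate, and \<open>word_step\<close> then yields the values at
  \<open>word (Suc n)\<close>.\<close>

lemma word_vals: "left_val b (- a) (word n) = y n \<and> right_val b (- a) (word n) = y (Suc n)"
  and word_step_ex: "\<exists>i j X. word n = replicate j False @ True # X
    \<and> word (Suc n) = replicate i True @ False # X \<and> K (Suc n) = int i + int j + 1"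
proof -
  have step: "\<exists>i j X. word n = replicate j False @ True # X
    \<and> word (Suc n) = replicate i True @ False # X \<and> K (Suc n) = int i + int j + 1"
    if v: "left_val b (- a) (word n) = y n" "right_val b (- a) (word n) = y (Suc n)" for n
  proof -
    \<comment> \<open>Without an \<open>A\<close> the right end would be \<open>1 / 0\<close>, where
      the form is \<open>- a < 0\<close>.\<close>
    have "True \<in> set (word n)"
    proof (rule ccontr)
      assume "True \<notin> set (word n)"
      then have "z = False" if "z \<in> set (word n)" for z using that by (cases z) auto
      then have "word n = replicate (length (word n)) False"
        by (intro replicate_eqI) auto
      then have "right_val b (- a) (word n) = - a" by (metis val_replicate(4))
      then show False using v y_bounds[of "Suc n"] ab by simp
    qed
    define j X where "j = length (takeWhile Not (word n))" and "X = tl (dropWhile Not (word n))"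
    have w: "word n = replicate j False @ True # X"
      unfolding j_def X_def by (rule leading_run) fact
    have "left_val b (- a) ((replicate j False @ [True]) @ X) > 0"
      using v y_bounds[of n] by (simp add: w)
    then have z: "left_val b (- a) X > 0" by (rule left_val_pos_suffix)
    \<comment> \<open>Hence \<open>(K (Suc n) - j) * y (Suc n)\<close> is the sum of
      \<open>y (Suc (Suc n))\<close> and the left value at \<open>X\<close>, both positive, so the
      digit exceeds the leading run.\<close>
    have "y n = left_val b (- a) X + j * y (Suc n)"
      using v unfolding w by (simp add: val_append val_replicate)
    then have "0 < (K (Suc n) - real j) * y (Suc n)"
      using z y_bounds[of "Suc (Suc n)"] by (simp add: y_Suc_Suc algebra_simps)
    then have "K (Suc n) > int j"
      using y_bounds[of "Suc n"] by (simp add: zero_less_mult_iff)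
    then have k: "K (Suc n) = int (nat (K (Suc n)) - j - 1) + int j + 1" by linarith
    have "word (Suc n) = replicate (nat (K (Suc n)) - j - 1) True @ False # X"
      by (simp add: word.simps(2) next_word_def j_def X_def)
    with w k show ?thesis by blast
  qed
  have vals: "left_val b (- a) (word n) = y n \<and> right_val b (- a) (word n) = y (Suc n)" for n
  proof (induction n)
    case 0
    then show ?case using K_bounds[of 0] by (simp add: val_replicate y_0 y_Suc_0 algebra_simps)
  next
    case (Suc n)
    then obtain i j X where *: "word n = replicate j False @ True # X"
      "word (Suc n) = replicate i True @ False # X" "K (Suc n) = int i + int j + 1"
      using step by blast
    show ?case
      using word_step(1,2)[OF *, of b "- a"] Suc by (simp add: y_Suc_Suc)
  qed
  show "left_val b (- a) (word n) = y n \<and> right_val b (- a) (word n) = y (Suc n)" by (rule vals)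
  show "\<exists>i j X. word n = replicate j False @ True # X
    \<and> word (Suc n) = replicate i True @ False # X \<and> K (Suc n) = int i + int j + 1"
    using step vals by blast
qed

lemma left_val_word: "left_val b (- a) (word n) = y n" "right_val b (- a) (word n) = y (Suc n)"
  using word_vals by auto

text \<open>Neighbouring leaves share an end, so \<open>q (Suc n)\<close> and
  \<open>p (Suc n)\<close> also describe the right end of \<open>word n\<close>.\<close>

lemma right_val_word: "right_val c d (word n) = left_val c d (word (Suc n))"
  using word_step_ex[of n] word_step(1) by metis

lemma height_word: "height (word n) = (\<Sum>i\<le>n. K i - 3) + 3"
proof (induction n)
  case 0
  show ?case using K_bounds[of 0] by simp
next
  case (Suc n)
  have "height (word (Suc n)) = height (word n) + K (Suc n) - 3"
    using word_step_ex[of n] word_step(3) by metis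
  then show ?case using Suc by simp
qed

text \<open>A step removes the leading run of \<open>B\<close> and adds a single
  \<open>B\<close>.\<close>

lemma count_False_word: "count_list (word n) False \<le> n"
proof (induction n)
  case 0
  show ?case by (simp add: count_list_replicate)
next
  case (Suc n)
  obtain i j X where *: "word n = replicate j False @ True # X"
    "word (Suc n) = replicate i True @ False # X" "K (Suc n) = int i + int j + 1"
    using word_step_ex by blast
  show ?case using word_step(4)[OF *] Suc by simp
qed

text \<open>Used to bound runs of \<open>A\<close>. An \<open>A\<close> is either inherited from the
  previous word or newly added, and all new ones share the left end with value
  \<open>y (Suc n)\<close>.\<close>

lemma left_end_word: "word n = Z @ True # X \<Longrightarrow> \<exists>i\<le>n. left_val b (- a) X = y i"
proof (induction n arbitrary: Z X)
  case 0
  then have "set X \<subseteq> {True}"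
    by (metis Un_upper2 set_append set_replicate_conv_if set_subset_Cons subset_trans word.simps(1)
        empty_subsetI subset_empty)
  then have "X = replicate (length X) True"
    by (intro replicate_eqI) auto
  then have "left_val b (- a) X = b" by (metis val_replicate(1))
  then show ?case by (simp add: y_0)
next
  case (Suc n)
  obtain i j X0 where *: "word n = replicate j False @ True # X0"
    "word (Suc n) = replicate i True @ False # X0" "K (Suc n) = int i + int j + 1"
    using word_step_ex by blast
  from Suc.prems *(2) consider
    us where "replicate i True = Z @ us" "us @ False # X0 = True # X"
    | us where "False # X0 = us @ True # X"
    by (metis append_eq_append_conv2)
  then show ?case
  proof cases
    case 1
    then obtain us' where us: "us = True # us'" "X = us' @ False # X0"
      by (cases us) auto
    have "set us' \<subseteq> set (replicate i True)" unfolding 1(1) us(1) by auto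
    then have "us' = replicate (length us') True"
      by (intro replicate_eqI) auto
    then obtain m where "us' = replicate m True" by blast
    then have "left_val b (- a) X = right_val b (- a) (word n)"
      unfolding us(2) *(1) by (simp add: val_append val_replicate)
    then show ?thesis by (auto simp: left_val_word intro: exI[of _ "Suc n"])
  next
    case 2
    then obtain us' where us: "X0 = us' @ True # X"
      by (cases us) auto
    have "word n = (replicate j False @ True # us') @ True # X" unfolding *(1) us by simp
    then show ?thesis using Suc.IH le_SucI by blast
  qed
qed

section \<open>Determinants and the time \<open>t\<close>\<close>

lemma y_eq: "y n = q n * b - p n * a"
  using val_linear(1)[of b "- a" "word n"] val_of_int(1)[of 1 0 "word n", where 'a = real]
    val_of_int(1)[of 0 1 "word n", where 'a = real]
  by (simp add: left_val_word q_def p_def)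

lemma q_ge_1: "q n \<ge> 1"
  unfolding q_def using val_nonneg(1)[of 1 0] by simp

lemma det_qp: "q n * p (Suc n) - p n * q (Suc n) = 1"
  using val_det[of 1 0 "word n" 0 "1 :: int"] by (simp add: q_def p_def right_val_word mult.commute)

lemma det_qy: "q (Suc n) * y n - q n * y (Suc n) = a"
proof -
  have "q (Suc n) * y n - q n * y (Suc n) = a * of_int (q n * p (Suc n) - p n * q (Suc n))"
    by (simp add: y_eq algebra_simps)
  then show ?thesis by (simp add: det_qp)
qed

lemma t_Suc: "t (Suc n) = t n + a / (y n * y (Suc n))"
  using det_qy[of n] y_bounds[of n] y_bounds[of "Suc n"] by (simp add: t_def field_simps)

lemma t_step: "t n + a \<le> t (Suc n)"
proof -
  have "y n * y (Suc n) \<le> 1" using y_bounds by (simp add: mult_le_one less_imp_le)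
  then have "a \<le> a / (y n * y (Suc n))"
    using y_bounds ab by (simp add: field_simps mult_left_le)
  then show ?thesis by (simp add: t_Suc)
qed

lemma t_mono: "m \<le> n \<Longrightarrow> t m \<le> t n"
proof (rule lift_Suc_mono_le[of t])
  show "t n \<le> t (Suc n)" for n using t_step[of n] ab by linarith
qed

lemma t_0: "t 0 = 1 / b"
  by (simp add: t_def q_def y_0 val_replicate)

lemma index_le_t: "a * n \<le> t n"
proof (induction n)
  case 0
  show ?case using ab by (simp add: t_0)
next
  case (Suc n)
  then show ?case using t_step[of n] by (simp add: algebra_simps)
qed

lemma q_le_t: "q n \<le> t n"
  using y_bounds[of n] q_ge_1[of n] by (simp add: t_def field_simps mult_left_le)

lemma t_ge_1: "t n \<ge> 1"
  using q_le_t[of n] q_ge_1[of n] by linarith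

text \<open>Each summand is the mean of two consecutive digits minus 3, so the sum is the full digit
  sum up to half of the last digit and half of the digit before the start; \<open>- 3\<close> undoes
  the constant in \<open>height_word\<close>.\<close>

lemma f_hat_eq:
  "f_hat (a, b) (Suc n) = real_of_int (height (word n)) - K n / 2 + itinerary (b, a) / 2 - 3"
proof -
  have hat: "itinerary_hat ((bcz ^^ Suc i) (a, b)) = (K (Suc i) + K i) / 2" for i
  proof -
    have "bcz_inv ((bcz ^^ Suc i) (a, b)) = (bcz ^^ i) (a, b)"
      using bij_betw_inv_into_left[OF bcz_bij orbit_in[of i]] by (simp add: bcz_inv_def)
    then show ?thesis by (simp only: itinerary_hat_def itinerary_T_def K_def of_int_add)
  qed
  show ?thesis
  proof (induction n)
    case 0
    show ?case
      using K_bounds(1)[of 0]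
      by (simp add: f_hat_def height_word itinerary_hat_def itinerary_T_eq[OF start] K_def
          field_simps)
  next
    case (Suc n)
    have "f_hat (a, b) (Suc (Suc n)) = f_hat (a, b) (Suc n) + (K (Suc n) + K n) / 2 - 3"
      unfolding f_hat_def by (simp add: hat del: funpow.simps)
    then show ?case using Suc by (simp add: height_word field_simps)
  qed
qed

end

section \<open>Upper bounds for the height\<close>

text \<open>The first bound increases with \<open>Q\<close>, the second decreases; up to the factor
  \<open>A\<close> they cross at \<open>Q = T powr (1 / v)\<close>.\<close>

lemma le_powr_of_two_bounds:
  fixes j Q T v m A :: real
  assumes "j \<le> A * Q powr (v - m)" "j \<le> T / Q powr m" "0 < m" "m \<le> v" "1 \<le> T" "1 \<le> Q" "1 \<le> A"
  shows "j \<le> A * T powr ((v - m) / v)"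
proof (cases "Q \<le> T powr (1 / v)")
  case True
  have "Q powr (v - m) \<le> (T powr (1 / v)) powr (v - m)"
    using True assms by (intro powr_mono2) auto
  also have "\<dots> = T powr ((v - m) / v)" by (simp add: powr_powr)
  finally have "A * Q powr (v - m) \<le> A * T powr ((v - m) / v)"
    using assms by (intro mult_left_mono) auto
  then show ?thesis using assms(1) by linarith
next
  case False
  have "T powr (m / v) = (T powr (1 / v)) powr m" by (simp add: powr_powr)
  also have "\<dots> \<le> Q powr m" using False assms by (intro powr_mono2) auto
  finally have "T / Q powr m \<le> T / T powr (m / v)"
    using assms by (intro divide_left_mono) auto
  also have "\<dots> = T powr (1 - m / v)" using assms by (simp add: powr_diff)
  also have "1 - m / v = (v - m) / v" using assms by (simp add: field_simps)
  also have "T powr ((v - m) / v) \<le> A * T powr ((v - m) / v)"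
    using assms by (simp add: mult_le_cancel_right1)
  finally show ?thesis using assms(2) by linarith
qed

context bcz_orbit
begin

text \<open>The left denominator can exceed the right one only through the leading run of
  \<open>B\<close>, whose length is at most \<open>n\<close>.\<close>

lemma q_prev_le: "real_of_int (q n) \<le> (real n + 1) * q (Suc n)"
proof -
  obtain i j X where *: "word n = replicate j False @ True # X"
    "word (Suc n) = replicate i True @ False # X" "K (Suc n) = int i + int j + 1"
    using word_step_ex by blast
  have "j \<le> n" using count_False_word[of n] by (simp add: *(1) count_list_replicate)
  have "q n = left_val 1 0 X + int j * q (Suc n)" "left_val 1 0 X \<le> q (Suc n)"
    using val_nonneg[of "1::int" 0 X]
    by (simp_all add: q_def right_val_word[symmetric] *(1) val_append val_replicate)
  then have "q n \<le> (int j + 1) * q (Suc n)" by (simp add: algebra_simps)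
  also have "\<dots> \<le> (int n + 1) * q (Suc n)"
    using \<open>j \<le> n\<close> q_ge_1[of "Suc n"] by (intro mult_right_mono) auto
  finally have "real_of_int (q n) \<le> real_of_int ((int n + 1) * q (Suc n))"
    by (simp only: of_int_le_iff)
  then show ?thesis by simp
qed

text \<open>If \<open>y n\<close> is small, the preceding value exceeds \<open>1 - y n\<close>, and
  by \<open>det_qy\<close> the ratio of the preceding denominator to \<open>q n\<close> is at least
  of order \<open>1 / y n\<close>; \<open>q_prev_le\<close> bounds this ratio.\<close>

lemma inverse_y_bound: "\<exists>C\<ge>1. \<forall>n. 1 / y n \<le> C * (real n + 1)"
proof -
  define c where "c = b - a * \<lfloor>b / a\<rfloor>"
  have "\<lfloor>b / a\<rfloor> \<noteq> b / a" using irrational by (metis Ints_of_int Ints_subset_Rats subsetD)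
  then have "\<lfloor>b / a\<rfloor> < b / a" by linarith
  then have c: "c > 0" using ab by (simp add: c_def field_simps)
  have "1 / y n \<le> (2 + 1 / c) * (real n + 1)" for n
  proof (cases "q n = 1")
    case True
    then have "p n < b / a" using y_eq[of n] y_bounds[of n] ab by (simp add: field_simps)
    then have "p n \<le> \<lfloor>b / a\<rfloor>" by linarith
    then have "a * p n \<le> a * \<lfloor>b / a\<rfloor>" using ab by simp
    then have "c \<le> y n" using y_eq[of n] True by (simp add: c_def mult.commute)
    then have "1 / y n \<le> 1 / c" using c by (simp add: frac_le)
    also have "\<dots> \<le> 2 + 1 / c" by simp
    also have "\<dots> \<le> (2 + 1 / c) * (real n + 1)" using c by (simp add: algebra_simps)
    finally show ?thesis .
  next
    case False
    have "q 0 = 1" by (simp add: q_def val_replicate)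
    then obtain m where n: "n = Suc m" using False by (cases n) auto
    have q2: "real_of_int (q n) \<ge> 2" using False q_ge_1[of n] by simp
    have "q n * (1 - y n) \<le> q n * y m"
      using q2 y_bounds(3)[of m] by (intro mult_left_mono) (auto simp: n)
    also have "\<dots> = a + q m * y n" using det_qy[of m] by (simp add: n)
    also have "\<dots> \<le> a + (real m + 1) * q n * y n"
      using q_prev_le[of m] y_bounds[of n] unfolding n by (intro add_mono mult_right_mono) auto
    finally have "q n - a \<le> q n * (y n * (real n + 1))" by (simp add: n algebra_simps)
    moreover have "q n * (1 / 2) \<le> q n - a" using q2 ab by simp
    ultimately have "q n * (1 / 2) \<le> q n * (y n * (real n + 1))" by linarith
    then have "1 / 2 \<le> y n * (real n + 1)" using q2 by (simp only: mult_le_cancel_left_pos)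
    then have "1 / y n \<le> 2 * (real n + 1)"
      using y_bounds[of n] by (simp add: field_simps)
    also have "\<dots> \<le> (2 + 1 / c) * (real n + 1)" using c by (intro mult_right_mono) auto
    finally show ?thesis .
  qed
  moreover have "2 + 1 / c \<ge> 1" using c by simp
  ultimately show ?thesis by blast
qed

section \<open>Bounds for single runs\<close>

lemma right_val_ge: "left_val b (- a) W > 0 \<Longrightarrow> right_val b (- a) W \<ge> - a"
proof (induction W)
  case (Cons x W)
  then have "left_val b (- a) W > 0" using left_val_pos_suffix[of "[x]" W] by simp
  then show ?case using Cons.IH by auto
qed auto

text \<open>The run adds \<open>j\<close> times the left value to the right value, which is at least
  \<open>- a\<close> before; once nonnegative, the right value never decreases and ends as
  \<open>y (Suc n) \<le> 1\<close>. Denominators only grow, whence the second bound.\<close>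

lemma run_True_bound:
  assumes w: "word n = Z @ replicate j True @ X"
  shows "j * left_val b (- a) X \<le> 2" "j * left_val (1::real) 0 X \<le> q (Suc n)"
proof -
  define l r where "l = left_val b (- a) X" and "r = right_val b (- a) X"
  have vW: "left_val c d (word n) = c' * left_val 1 0 Z + (d' + j * c') * left_val 0 1 Z"
    "right_val c d (word n) = c' * right_val 1 0 Z + (d' + j * c') * right_val 0 1 Z"
    if "c' = left_val c d X" "d' = right_val c d X" for c d c' d' :: real
    using that val_linear[of c' "d' + j * c'" Z] by (simp_all add: w val_append val_replicate)
  note pos = val_nonneg[of "1::real" 0 Z] val_nonneg[of "0::real" 1 Z]
  have "left_val b (- a) ((Z @ replicate j True) @ X) > 0"
    using left_val_word[of n] y_bounds[of n] by (simp add: w)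
  then have l: "l > 0" unfolding l_def by (rule left_val_pos_suffix)
  have r: "r \<ge> - a" using right_val_ge l unfolding l_def r_def by blast
  have "j * l \<le> 1 - r \<or> j * l \<le> - r"
  proof (cases "r + j * l \<ge> 0")
    case True
    have "r + j * l \<le> (r + j * l) * right_val 0 1 Z" using True pos by (simp add: mult_le_cancel_left1)
    also have "\<dots> \<le> right_val b (- a) (word n)"
      using vW(2)[of l b "- a" r] l pos by (simp add: l_def r_def)
    also have "\<dots> \<le> 1" using left_val_word y_bounds by simp
    finally show ?thesis by simp
  qed simp
  then show "j * left_val b (- a) X \<le> 2" using r ab unfolding l_def by linarith
  have Q: "left_val 1 0 X \<ge> (1::real)" "right_val 1 0 X \<ge> (0::real)"
    using val_nonneg[of "1::real" 0 X] by auto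
  define m where "m = right_val 1 0 X + j * left_val (1::real) 0 X"
  have m: "j * left_val (1::real) 0 X \<le> m" "m \<ge> 0" using Q by (simp_all add: m_def)
  have "m * 1 \<le> m * right_val (0::real) 1 Z" using m pos by (intro mult_left_mono) simp_all
  then have "j * left_val (1::real) 0 X \<le> m * right_val (0::real) 1 Z" using m by linarith
  also have "\<dots> \<le> right_val 1 0 (word n)"
    using vW(2)[of "left_val 1 0 X" 1 0 "right_val 1 0 X"] Q pos by (simp add: m_def)
  also have "\<dots> = q (Suc n)"
    using val_of_int(2)[of 1 0 "word n", where 'a = real] by (simp add: q_def right_val_word)
  finally show "j * left_val (1::real) 0 X \<le> q (Suc n)" .
qed

lemma form_nonzero: "Q \<noteq> 0 \<or> P \<noteq> 0 \<Longrightarrow> of_int Q * b - of_int P * a \<noteq> 0"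
proof
  assume QP: "Q \<noteq> 0 \<or> P \<noteq> 0" and eq: "of_int Q * b - of_int P * a = 0"
  then have "Q \<noteq> 0" using ab by auto
  then have "b / a = of_int P / of_int Q" using eq ab by (simp add: field_simps)
  then show False using irrational by (auto intro: Rats_divide Rats_of_int)
qed

text \<open>The run turns around the right end of \<open>X\<close>. The cases are a lower fraction,
  treated like a run of \<open>A\<close>, an upper fraction with \<open>Q \<ge> 1\<close>, where the
  determinant is decisive, and the point \<open>1 / 0\<close>.\<close>

lemma run_False_bound:
  fixes l r Q :: real
  assumes w: "word n = Z @ replicate j False @ X"
  defines "r \<equiv> right_val b (- a) X" and "Q \<equiv> right_val 1 0 X"
  shows "(r > 0 \<and> j * r \<le> 1 \<and> j * Q \<le> q n)
    \<or> (r < 0 \<and> Q \<ge> 1 \<and> j * Q * (- r) \<le> 1 \<and> j * Q\<^sup>2 \<le> t n) \<or> j \<le> b / a"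
proof -
  define l Q' where "l = left_val b (- a) X" and "Q' = left_val (1::real) 0 X"
  \<comment> \<open>The final left vector is \<open>\<alpha>\<close> times the left vector after the
    run plus \<open>\<beta>\<close> times the right vector.\<close>
  define \<alpha> \<beta> where "\<alpha> = left_val (1::real) 0 Z" and "\<beta> = left_val (0::real) 1 Z"
  have vW: "left_val c d (word n) = (c' + j * d') * \<alpha> + d' * \<beta>"
    if "c' = left_val c d X" "d' = right_val c d X" for c d c' d' :: real
    using that val_linear[of "c' + j * d'" d' Z]
    by (simp add: w val_append val_replicate \<alpha>_def \<beta>_def)
  have pos: "\<alpha> \<ge> 1" "\<beta> \<ge> 0"
    using val_nonneg[of "1::real" 0 Z] val_nonneg[of "0::real" 1 Z] by (auto simp: \<alpha>_def \<beta>_def)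
  have QQ: "Q' \<ge> 1" "Q \<ge> 0"
    using val_nonneg[of "1::real" 0 X] by (auto simp: Q_def Q'_def)
  have y: "y n = (l + j * r) * \<alpha> + r * \<beta>"
    using vW[of l b "- a" r] left_val_word by (simp add: l_def r_def)
  have "q n = left_val (1::real) 0 (word n)"
    using val_of_int(1)[of 1 0 "word n", where 'a = real] by (simp add: q_def)
  then have q: "q n = (Q' + j * Q) * \<alpha> + Q * \<beta>"
    using vW[of Q' 1 0 Q] by (simp add: Q_def Q'_def)
  have "left_val b (- a) (Z @ replicate j False @ X) > 0"
    using left_val_word[of n] y_bounds[of n] by (simp add: w)
  then have l': "l + j * r > 0"
    using left_val_pos_suffix[of Z "replicate j False @ X"]
    by (simp add: val_append val_replicate l_def r_def)
  have "left_val b (- a) ((Z @ replicate j False) @ X) > 0"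
    using left_val_word[of n] y_bounds[of n] by (simp add: w)
  then have l: "l > 0" unfolding l_def by (rule left_val_pos_suffix)
  have det: "Q * l - Q' * r = a"
    using val_det[of 1 0 X b "- a"] by (simp add: Q_def Q'_def l_def r_def algebra_simps)
  obtain Qi Pi where QP: "Qi = right_val (1::int) 0 X" "Pi = right_val (0::int) 1 X" by blast
  have Qi: "Q = of_int Qi" using val_of_int(2)[of 1 0 X, where 'a = real] by (simp add: QP Q_def)
  have Pi: "right_val 0 1 X = real_of_int Pi" "Pi \<ge> 1"
    using val_of_int(2)[of 0 1 X, where 'a = real] val_nonneg[of "0::int" 1 X] by (auto simp: QP)
  have "r = Q * b - Pi * a"
    using val_linear(2)[of b "- a" X] by (simp add: r_def Q_def Pi)
  then have "r \<noteq> 0" using form_nonzero[of Qi Pi] Pi Qi by simp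
  then consider "r > 0" | "r < 0" "Qi \<ge> 1" | "r < 0" "Qi = 0"
    using QQ Qi by fastforce
  then show ?thesis
  proof cases
    case 1
    have "j * r \<le> (l + j * r) * 1 + 0" using l by simp
    also have "\<dots> \<le> (l + j * r) * \<alpha> + r * \<beta>"
      using l' 1 pos by (intro add_mono mult_left_mono) auto
    also have "\<dots> \<le> 1" using y y_bounds[of n] by simp
    finally have "j * r \<le> 1" .
    have "j * Q \<le> (Q' + j * Q) * 1 + 0" using QQ by simp
    also have "\<dots> \<le> (Q' + j * Q) * \<alpha> + Q * \<beta>"
      using QQ pos by (intro add_mono mult_left_mono) auto
    also have "\<dots> = q n" using q by simp
    finally show ?thesis using 1 \<open>j * r \<le> 1\<close> by blast
  next
    case 2
    have Q1: "Q \<ge> 1" using 2 Qi by simp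
    \<comment> \<open>For an upper fraction both summands are nonnegative, so each is at most
      \<open>a\<close>.\<close>
    have det': "Q * (l + j * r) + (Q' + j * Q) * (- r) = a"
      using det by (simp add: algebra_simps)
    moreover have "Q * (l + j * r) \<ge> 0" "Q' * (- r) \<ge> 0"
      using l' QQ 2 by (auto intro!: mult_nonneg_nonneg mult_nonneg_nonpos)
    ultimately have "j * Q * (- r) \<le> 1" and lQ: "Q * (l + j * r) \<le> a"
      using ab mult_nonneg_nonneg[of "Q' + j * Q" "- r"] QQ 2 by (auto simp: algebra_simps)
    have "r * \<beta> \<le> 0" using 2 pos by (simp add: mult_nonpos_nonneg)
    then have "Q * (r * \<beta>) \<le> 0" by (rule mult_nonneg_nonpos[OF QQ(2)])
    have "Q * y n = (Q * (l + j * r)) * \<alpha> + Q * (r * \<beta>)" using y by (simp add: algebra_simps)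
    also have "\<dots> \<le> 1 * \<alpha> + 0"
      using lQ ab pos \<open>Q * (r * \<beta>) \<le> 0\<close> by (intro add_mono mult_right_mono) auto
    finally have "Q * y n \<le> \<alpha>" by simp
    then have "(j * Q) * (Q * y n) \<le> (j * Q) * \<alpha>" using QQ by (intro mult_left_mono) auto
    also have "\<dots> \<le> q n" using QQ pos by (simp add: q algebra_simps)
    finally have "j * Q\<^sup>2 \<le> t n"
      using y_bounds[of n] by (simp add: t_def field_simps power2_eq_square)
    then show ?thesis using 2 Q1 \<open>j * Q * (- r) \<le> 1\<close> by blast
  next
    \<comment> \<open>Here the right end is \<open>1 / 0\<close>, and the run only moves the left
      end to larger integers, which stay below \<open>b / a\<close>.\<close>
    case 3
    then have Q0: "Q = 0" using Qi by simp
    have "left_val (1::int) 0 X * Pi = 1"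
      using val_det[of "1::int" 0 X 0 1] 3 by (simp add: QP)
    then have "left_val (1::int) 0 X = 1" "Pi = 1"
      using Pi val_nonneg[of "1::int" 0 X] by (simp_all add: zmult_eq_1_iff)
    then have "Q' = 1" "r = - a"
      using val_of_int(1)[of 1 0 X, where 'a = real] \<open>r = Q * b - Pi * a\<close> Q0
      by (simp_all add: Q'_def)
    moreover have "l = Q' * b - left_val 0 1 X * a"
      using val_linear(1)[of b "- a" X] by (simp add: l_def Q'_def)
    moreover have "left_val 0 1 X * a \<ge> 0" using val_nonneg[of "0::real" 1 X] ab by simp
    ultimately have "j * a \<le> b" using l' by simp
    then show ?thesis using ab by (simp add: field_simps)
  qed
qed

section \<open>Length of the addresses and growth of \<open>t\<close>\<close>

lemma vals_word_le: "left_val 1 1 (word n) + right_val 1 1 (word n) \<le> 2 * (1 + b / a) * t (Suc n)"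
proof -
  have pq: "p m \<le> b / a * q m" for m
    using y_eq[of m] y_bounds[of m] ab by (simp add: field_simps)
  have l: "left_val 1 1 (word m) = real_of_int (q m) + real_of_int (p m)" for m
    using val_linear(1)[of "1::real" 1 "word m"] val_of_int(1)[of 1 0 "word m", where 'a = real]
      val_of_int(1)[of 0 1 "word m", where 'a = real] by (simp add: q_def p_def)
  have "left_val 1 1 (word m) \<le> (1 + b / a) * t (Suc n)" if "m \<le> Suc n" for m
  proof -
    have "left_val 1 1 (word m) \<le> (1 + b / a) * q m" using pq[of m] by (simp add: l algebra_simps)
    also have "\<dots> \<le> (1 + b / a) * t (Suc n)"
      using q_le_t[of m] t_mono[OF that] ab by (intro mult_left_mono) auto
    finally show ?thesis .
  qed
  from this[of n] this[of "Suc n"]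
  have "left_val 1 1 (word n) + right_val 1 1 (word n) \<le> 2 * ((1 + b / a) * t (Suc n))"
    by (simp add: right_val_word)
  then show ?thesis by (simp only: mult.assoc)
qed

lemma length_word_le:
  assumes "\<And>Z j x X. word n = Z @ replicate j x @ X \<Longrightarrow> real j \<le> B"
  shows "length (word n) \<le> (B + 1) * (log 2 (2 * (1 + b / a) * t (Suc n)) + 1)"
proof -
  have "B \<ge> 0" using assms[of "[]" 0 True "word n"] by simp
  have "left_val 1 1 (word n) \<ge> (1::real)" "right_val 1 1 (word n) \<ge> (1::real)"
    using val_nonneg[of "1::real" 1] by auto
  then have "log 2 (left_val 1 1 (word n) + right_val 1 1 (word n)) \<le> log 2 (2 * (1 + b / a) * t (Suc n))"
    using vals_word_le[of n] by (subst log_le_cancel_iff) auto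
  then have "(B + 1) * (log 2 (left_val 1 1 (word n) + right_val 1 1 (word n)) + 1)
    \<le> (B + 1) * (log 2 (2 * (1 + b / a) * t (Suc n)) + 1)"
    using \<open>B \<ge> 0\<close> by (intro mult_left_mono) auto
  moreover have "length (word n) \<le> (B + 1) * (log 2 (left_val 1 1 (word n) + right_val 1 1 (word n)) + 1)"
    by (rule length_le_of_runs) (rule assms)
  ultimately show ?thesis by linarith
qed

text \<open>Sums return times of order at most \<open>n^2\<close>. Any polynomial bound would do,
  since it enters only through a logarithm.\<close>

lemma t_cubic_bound: "\<exists>D\<ge>1. \<forall>n. t n \<le> D * (real n + 1) ^ 3"
proof -
  obtain C where C: "C \<ge> 1" "\<And>n. 1 / y n \<le> C * (real n + 1)" using inverse_y_bound by blast
  define D where "D = C\<^sup>2 + 1 / b"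
  have D: "D \<ge> 1" "D \<ge> 1 / b" "D \<ge> C\<^sup>2"
    using C ab by (auto simp: D_def intro!: add_increasing2)
  have "t n \<le> D * (real n + 1) ^ 3" for n
  proof (induction n)
    case 0
    then show ?case using D by (simp add: t_0)
  next
    case (Suc n)
    have "a / (y n * y (Suc n)) \<le> (1 / y n) * (1 / y (Suc n))"
      using ab y_bounds[of n] y_bounds[of "Suc n"] by (simp add: divide_right_mono)
    also have "\<dots> \<le> (C * (real n + 1)) * (C * (real (Suc n) + 1))"
      using C(1) C(2)[of n] C(2)[of "Suc n"] y_bounds[of "Suc n"] by (intro mult_mono) auto
    also have "\<dots> = C\<^sup>2 * ((real n + 1) * (real n + 2))" by (simp add: power2_eq_square algebra_simps)
    also have "\<dots> \<le> D * ((real n + 1) * (real n + 2))" using D by (intro mult_right_mono) auto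
    also have "\<dots> \<le> D * ((real n + 2) ^ 3 - (real n + 1) ^ 3)"
      using D by (intro mult_left_mono) (auto simp: power3_eq_cube algebra_simps)
    finally show ?case using Suc by (simp add: t_Suc algebra_simps)
  qed
  then show ?thesis using D by blast
qed

text \<open>A bound independent of the exponents: all runs are \<open>O(n)\<close>, those of
  \<open>A\<close> because their left ends are visited, those of \<open>B\<close> by counting. It
  yields \<open>t_growth\<close> and covers infinite exponents.\<close>

lemma length_word_crude:
  assumes "\<epsilon> > 0"
  shows "\<forall>\<^sub>F n in sequentially. length (word n) \<le> real n powr (1 + \<epsilon>)"
proof -
  obtain C where C: "C \<ge> 1" "\<And>n. 1 / y n \<le> C * (real n + 1)" using inverse_y_bound by blast
  obtain D where D: "D \<ge> 1" "\<And>n. t n \<le> D * (real n + 1) ^ 3" using t_cubic_bound by blast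
  define E where "E = 2 * (1 + b / a) * D"
  have E: "E > 0" using D ab by (simp add: E_def add_pos_pos)
  have bound: "length (word n) \<le> (2 * C * (real n + 1) + 1) * (log 2 (E * (real n + 2) ^ 3) + 1)" for n
  proof -
    have run: "real j \<le> 2 * C * (real n + 1)" if w: "word n = Z @ replicate j x @ X" for Z j x X
    proof (cases x)
      case x: True
      show ?thesis
      proof (cases j)
        case (Suc i)
        then have "word n = (Z @ replicate i True) @ True # X"
          using w x by (simp add: replicate_append_same[symmetric])
        then obtain m where m: "m \<le> n" "left_val b (- a) X = y m" using left_end_word by blast
        have "j * y m \<le> 2" using run_True_bound(1)[of n Z j X] w x m by simp
        then have "j \<le> 2 * (1 / y m)" using y_bounds[of m] by (simp add: field_simps)
        also have "\<dots> \<le> 2 * (C * (real m + 1))" using C(2)[of m] by simp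
        also have "\<dots> \<le> 2 * (C * (real n + 1))" using C(1) m by simp
        finally show ?thesis by simp
      qed (use C in simp)
    next
      case False
      have "j \<le> count_list (word n) False" using w False by (simp add: count_list_replicate)
      then have "real j \<le> real n" using count_False_word[of n] by linarith
      also have "\<dots> \<le> 1 * (real n + 1)" by simp
      also have "\<dots> \<le> 2 * C * (real n + 1)" using C by (intro mult_right_mono) auto
      finally show ?thesis .
    qed
    have "2 * (1 + b / a) * t (Suc n) \<le> 2 * (1 + b / a) * (D * (real (Suc n) + 1) ^ 3)"
      using D(2)[of "Suc n"] ab by (intro mult_left_mono) auto
    then have le: "2 * (1 + b / a) * t (Suc n) \<le> E * (real n + 2) ^ 3"
      by (simp add: E_def algebra_simps)
    have "2 * (1 + b / a) * t (Suc n) > 0"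
      using t_ge_1[of "Suc n"] ab by (intro mult_pos_pos add_pos_pos) auto
    then have "log 2 (2 * (1 + b / a) * t (Suc n)) \<le> log 2 (E * (real n + 2) ^ 3)"
      using le by (subst log_le_cancel_iff) linarith+
    then have "(2 * C * (real n + 1) + 1) * (log 2 (2 * (1 + b / a) * t (Suc n)) + 1)
      \<le> (2 * C * (real n + 1) + 1) * (log 2 (E * (real n + 2) ^ 3) + 1)"
      using C by (intro mult_left_mono) auto
    moreover have "length (word n) \<le> (2 * C * (real n + 1) + 1) *
        (log 2 (2 * (1 + b / a) * t (Suc n)) + 1)"
      by (rule length_word_le) (rule run)
    ultimately show ?thesis by linarith
  qed
  have "C > 0" using C by simp
  have "\<forall>\<^sub>F n in sequentially. (2 * C * (real n + 1) + 1) * (log 2 (E * (real n + 2) ^ 3) + 1)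
    \<le> real n powr (1 + \<epsilon>)"
    using \<open>C > 0\<close> E assms by real_asymp
  then show ?thesis
  proof eventually_elim
    case (elim n)
    show ?case using order_trans[OF bound elim] .
  qed
qed

text \<open>The time \<open>t n\<close> is a sum of the return times \<open>a / (y n * y (Suc n))\<close>, which are controlled by
  the digits \<open>K n\<close>, whose sum is the height.\<close>

lemma t_le_height: "t n \<le> 1 / b + 2 * height (word n) + 8 * (real n + 1) - K n"
proof (induction n)
  case 0
  show ?case using K_bounds(1)[of 0] by (simp add: t_0)
next
  case (Suc n)
  have "height (word (Suc n)) = height (word n) + K (Suc n) - 3" by (simp add: height_word)
  \<comment> \<open>As \<open>a \<le> 1 < y n + y (Suc n)\<close>, the return time is below
    \<open>K n + K (Suc n) + 2\<close>. In the sum a digit occurs twice except at the end, hence the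
    term \<open>- K n\<close> of the claim.\<close>
  moreover have "a / (y n * y (Suc n)) \<le> (y n + y (Suc n)) / (y n * y (Suc n))"
    using ab y_bounds[of n] y_bounds[of "Suc n"] by (intro divide_right_mono) auto
  moreover have "\<dots> = 1 / y (Suc n) + 1 / y n"
    using y_bounds[of n] y_bounds[of "Suc n"] by (simp add: field_simps)
  ultimately show ?case
    using Suc K_bounds(2)[of n] K_bounds(2)[of "Suc n"] by (simp add: t_Suc)
qed

lemma t_growth:
  assumes "\<epsilon> > 0"
  shows "\<forall>\<^sub>F n in sequentially. t (Suc n) \<le> real n powr (1 + \<epsilon>)"
proof -
  have "\<forall>\<^sub>F n in sequentially. length (word (Suc n)) \<le> real (Suc n) powr (1 + \<epsilon> / 2)"
    using length_word_crude[of "\<epsilon> / 2"] assms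
    by (subst eventually_sequentially_Suc[of "\<lambda>n. length (word n) \<le> real n powr (1 + \<epsilon> / 2)"]) simp
  moreover have "\<forall>\<^sub>F n in sequentially.
      1 / b + 2 * real (Suc n) powr (1 + \<epsilon> / 2) + 8 * (real (Suc n) + 1) \<le> real n powr (1 + \<epsilon>)"
    using assms ab by real_asymp
  ultimately show ?thesis
  proof eventually_elim
    case (elim n)
    have "real_of_int (height (word (Suc n))) \<le> real (length (word (Suc n)))"
      using abs_height_le[of "word (Suc n)"] by linarith
    then show ?case using t_le_height[of "Suc n"] K_bounds(1)[of "Suc n"] elim by linarith
  qed
qed

text \<open>The hypotheses \<open>odd\<close> and \<open>even\<close> bound runs around lower and
  upper fractions; \<open>le_powr_of_two_bounds\<close> with \<open>m = 1\<close> and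
  \<open>m = 2\<close> gives their exponents in terms of \<open>t\<close>.\<close>

lemma length_word_growth:
  fixes v v' c \<theta> :: real
  assumes odd: "\<And>(P :: int) (Q :: int). Q \<ge> 1 \<Longrightarrow> Q * b - P * a > 0 \<Longrightarrow> Q * b - P * a \<ge> c * Q powr (1 - v)"
    and even: "\<And>(P :: int) (Q :: int). Q \<ge> 1 \<Longrightarrow> Q * b - P * a < 0 \<Longrightarrow> P * a - Q * b \<ge> c * Q powr (1 - v')"
    and c: "c > 0" and v: "v \<ge> 2" "v' \<ge> 2" and \<theta>: "(v - 1) / v \<le> \<theta>" "(v' - 2) / v' \<le> \<theta>" "\<theta> \<le> 1"
    and \<epsilon>: "\<epsilon> > 0"
  shows "\<forall>\<^sub>F n in sequentially. length (word n) \<le> real n powr (\<theta> + \<epsilon>)"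
proof -
  \<comment> \<open>The summands cover lower fractions (\<open>2 / c\<close>), upper fractions
    (\<open>1 / c\<close>) and runs around \<open>1 / 0\<close> (\<open>b / a\<close>).\<close>
  define C where "C = 1 + 2 / c + b / a"
  have C: "C \<ge> 1" "C \<ge> 2 / c" "C \<ge> 1 / c" "C \<ge> b / a"
  proof -
    have "1 / c > 0" "b / a > 0" "2 / c = 1 / c + 1 / c" using c ab by auto
    then show "C \<ge> 1" "C \<ge> 2 / c" "C \<ge> 1 / c" "C \<ge> b / a" unfolding C_def by linarith+
  qed
  have \<theta>0: "\<theta> > 0" using v(1) \<theta>(1) by (smt (verit) divide_pos_pos)
  have run: "real j \<le> C * t (Suc n) powr \<theta>" if w: "word n = Z @ replicate j x @ X" for n Z j x X
  proof -
    define T where "T = t (Suc n)"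
    have T: "T \<ge> 1" "t n \<le> T" "q (Suc n) \<le> T" "q n \<le> T"
      using t_ge_1[of "Suc n"] t_mono[of n "Suc n"] q_le_t[of n] q_le_t[of "Suc n"]
      by (auto simp: T_def)
    have lower: "real j \<le> C * T powr \<theta>"
      if "Q \<ge> 1" "Q * b - P * a > 0" "j * (Q * b - P * a) \<le> 2" "real j * of_int Q \<le> T" for Q P :: int
    proof -
      have "j * (c * Q powr (1 - v)) \<le> j * (Q * b - P * a)"
        using odd that by (intro mult_left_mono) auto
      then have "j * (c * Q powr (1 - v)) \<le> 2" using that by linarith
      then have "j \<le> (2 / c) * Q powr (v - 1)"
        using c that by (simp add: powr_diff field_simps)
      also have "\<dots> \<le> C * Q powr (v - 1)" using C by (intro mult_right_mono) auto
      finally have "real j \<le> C * Q powr (v - 1)" .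
      moreover have "real j \<le> T / real_of_int Q powr 1" using that by (simp add: field_simps)
      ultimately have "real j \<le> C * T powr ((v - 1) / v)"
        by (rule le_powr_of_two_bounds) (use v T C that in auto)
      also have "\<dots> \<le> C * T powr \<theta>" using \<theta> T C by (intro mult_left_mono powr_mono) auto
      finally show ?thesis .
    qed
    have upper: "real j \<le> C * T powr \<theta>"
      if "Q \<ge> 1" "Q * b - P * a < 0" "j * Q * (P * a - Q * b) \<le> 1" "j * (of_int Q)\<^sup>2 \<le> T" for Q P :: int
    proof -
      have "j * Q * (c * Q powr (1 - v')) \<le> j * Q * (P * a - Q * b)"
        using even that by (intro mult_left_mono) auto
      then have "j * Q * (c * Q powr (1 - v')) \<le> 1" using that by linarith
      then have "j \<le> (1 / c) * Q powr (v' - 2)"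
        using c that by (simp add: powr_diff field_simps power2_eq_square)
      also have "\<dots> \<le> C * Q powr (v' - 2)" using C by (intro mult_right_mono) auto
      finally have "real j \<le> C * Q powr (v' - 2)" .
      moreover have "real j \<le> T / real_of_int Q powr 2" using that by (simp add: field_simps)
      ultimately have "real j \<le> C * T powr ((v' - 2) / v')"
        by (rule le_powr_of_two_bounds) (use v T C that in auto)
      also have "\<dots> \<le> C * T powr \<theta>" using \<theta> T C by (intro mult_left_mono powr_mono) auto
      finally show ?thesis .
    qed
    have "real j \<le> C * T powr \<theta>"
    proof (cases x)
      case True
      define Q P where "Q = left_val (1::int) 0 X" and "P = left_val (0::int) 1 X"
      have Q: "left_val 1 0 X = real_of_int Q" "left_val b (- a) X = Q * b - P * a" "Q \<ge> 1"
        using val_linear(1)[of b "- a" X] val_of_int(1)[of 1 0 X, where 'a = real]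
          val_of_int(1)[of 0 1 X, where 'a = real] val_nonneg(1)[of "1::int" 0 X]
        by (auto simp: Q_def P_def)
      have "left_val b (- a) ((Z @ replicate j x) @ X) > 0"
        using left_val_word[of n] y_bounds[of n] by (simp add: w)
      then have "left_val b (- a) X > 0" by (rule left_val_pos_suffix)
      moreover have "j * left_val b (- a) X \<le> 2" "j * left_val (1::real) 0 X \<le> T"
        using run_True_bound[of n Z j X] w True T by auto
      ultimately show ?thesis using lower[of Q P] Q by simp
    next
      case False
      define Q P where "Q = right_val (1::int) 0 X" and "P = right_val (0::int) 1 X"
      have Q: "right_val 1 0 X = real_of_int Q" "right_val b (- a) X = Q * b - P * a" "Q \<ge> 0" "P \<ge> 0"
        using val_linear(2)[of b "- a" X] val_of_int(2)[of 1 0 X, where 'a = real]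
          val_of_int(2)[of 0 1 X, where 'a = real] val_nonneg(2)[of "1::int" 0 X]
          val_nonneg(2)[of "0::int" 1 X]
        by (auto simp: Q_def P_def)
      have "word n = Z @ replicate j False @ X" using w False by simp
      from run_False_bound[OF this] consider
        "Q * b - P * a > 0" "j * (Q * b - P * a) \<le> 1" "real j * of_int Q \<le> q n"
        | "Q * b - P * a < 0" "Q \<ge> 1" "j * Q * (P * a - Q * b) \<le> 1" "j * (of_int Q)\<^sup>2 \<le> t n"
        | "j \<le> b / a"
        unfolding Q by auto
      then show ?thesis
      proof cases
        case 1
        have "Q * b > 0" using 1 Q(4) ab by (smt (verit) mult_nonneg_nonneg of_int_nonneg)
        then have "Q \<ge> 1" using ab by (simp add: zero_less_mult_iff)
        then show ?thesis using lower[of Q P] 1 T by simp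
      next
        case 2
        then show ?thesis using upper[of Q P] T by simp
      next
        case 3
        have "b / a \<le> C * 1" using C by simp
        also have "\<dots> \<le> C * T powr \<theta>"
          using C T \<theta>0 by (intro mult_left_mono ge_one_powr_ge_zero) auto
        finally show ?thesis using 3 by simp
      qed
    qed
    then show ?thesis by (simp add: T_def)
  qed
  define E where "E = 2 * (1 + b / a)"
  have E: "E > 0" using ab by (simp add: E_def add_pos_pos)
  \<comment> \<open>Half of \<open>\<epsilon>\<close> is spent on the growth of \<open>t\<close>,
    the other half absorbs the logarithm.\<close>
  have "\<forall>\<^sub>F n in sequentially. (C * real n powr (\<theta> + \<epsilon> / 2) + 1) *
    (log 2 (E * real n powr (1 + \<epsilon> / 2)) + 1) \<le> real n powr (\<theta> + \<epsilon>)"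
  proof -
    have "C > 0" using C by simp
    then show ?thesis using E \<epsilon> \<theta>0 by real_asymp
  qed
  moreover have "\<forall>\<^sub>F n in sequentially. t (Suc n) \<le> real n powr (1 + \<epsilon> / 2)"
    using t_growth \<epsilon> by simp
  moreover have "\<forall>\<^sub>F n in sequentially. n \<ge> 1" by (rule eventually_ge_at_top)
  ultimately show ?thesis
  proof eventually_elim
    case (elim n)
    define T where "T = t (Suc n)"
    have T: "T \<ge> 1" "T \<le> real n powr (1 + \<epsilon> / 2)" using elim t_ge_1 by (auto simp: T_def)
    have n: "real n \<ge> 1" using elim by simp
    have "T powr \<theta> \<le> (real n powr (1 + \<epsilon> / 2)) powr \<theta>"
      using T \<theta>0 by (intro powr_mono2) auto
    also have "\<dots> = real n powr (\<theta> + \<epsilon> / 2 * \<theta>)" by (simp add: powr_powr algebra_simps)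
    also have "\<dots> \<le> real n powr (\<theta> + \<epsilon> / 2)"
      using n \<theta> \<epsilon> by (intro powr_mono) (auto simp: mult_left_le)
    finally have "C * T powr \<theta> \<le> C * real n powr (\<theta> + \<epsilon> / 2)" using C by simp
    moreover have "log 2 (E * T) \<le> log 2 (E * real n powr (1 + \<epsilon> / 2))"
      using T E n by (subst log_le_cancel_iff) auto
    moreover have "log 2 (E * T) \<ge> 0"
    proof -
      have "E \<ge> 1" using ab by (simp add: E_def add_increasing2)
      then have "1 \<le> E * T" using T mult_mono[of 1 E 1 T] by simp
      then show ?thesis by simp
    qed
    moreover have "C * T powr \<theta> \<ge> 0" using C by simp
    ultimately have "(C * T powr \<theta> + 1) * (log 2 (E * T) + 1)
      \<le> (C * real n powr (\<theta> + \<epsilon> / 2) + 1) * (log 2 (E * real n powr (1 + \<epsilon> / 2)) + 1)"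
      by (intro mult_mono) auto
    moreover have "length (word n) \<le> (C * T powr \<theta> + 1) * (log 2 (E * T) + 1)"
      using length_word_le[of n "C * T powr \<theta>"] run by (auto simp: T_def E_def)
    ultimately show ?case using elim by linarith
  qed
qed

end

section \<open>Lower bounds\<close>

text \<open>The growth exponent in epsilon form, which avoids logarithms of 0 and is easily
  shifted.\<close>

definition grows :: "(nat \<Rightarrow> real) \<Rightarrow> real \<Rightarrow> bool" where
  "grows f \<theta> \<longleftrightarrow> (\<forall>\<epsilon>>0. (\<forall>\<^sub>F n in sequentially. \<bar>f n\<bar> \<le> real n powr (\<theta> + \<epsilon>)) \<and>
     (\<exists>\<^sub>F n in sequentially. real n powr (\<theta> - \<epsilon>) \<le> \<bar>f n\<bar>))"

lemma growth_exp_eqI: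
  assumes "grows f \<theta>"
  shows "growth_exp f = ereal \<theta>"
proof (rule antisym)
  let ?r = "\<lambda>n. elog \<bar>f n\<bar> / elog (real n)"
  have quot: "?r n = (if f n = 0 then - \<infinity> else ereal (ln \<bar>f n\<bar> / ln n))" "ln n > 0" if "n \<ge> 2" for n :: nat
    using that by (auto simp: elog_def ln_gt_zero)
  show "growth_exp f \<le> ereal \<theta>"
  proof (rule ereal_le_epsilon2)
    fix \<epsilon> :: real assume "\<epsilon> > 0"
    then have "\<forall>\<^sub>F n in sequentially. \<bar>f n\<bar> \<le> real n powr (\<theta> + \<epsilon>)"
      using assms by (auto simp: grows_def)
    moreover have "\<forall>\<^sub>F n in sequentially. n \<ge> 2" by (rule eventually_ge_at_top)
    ultimately have "\<forall>\<^sub>F n in sequentially. ?r n \<le> ereal (\<theta> + \<epsilon>)"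
    proof eventually_elim
      case (elim n)
      have "ln \<bar>f n\<bar> \<le> ln (real n powr (\<theta> + \<epsilon>))" if "f n \<noteq> 0"
        using elim that by (subst ln_le_cancel_iff) auto
      then have "ln \<bar>f n\<bar> / ln n \<le> \<theta> + \<epsilon>" if "f n \<noteq> 0"
        using that elim quot(2)[of n] by (simp add: ln_powr field_simps)
      then show ?case using quot[of n] elim by auto
    qed
    then show "growth_exp f \<le> ereal \<theta> + ereal \<epsilon>"
      unfolding growth_exp_def by (auto intro: Limsup_bounded)
  qed
  show "ereal \<theta> \<le> growth_exp f"
  proof (rule ereal_le_epsilon2)
    fix \<epsilon> :: real assume "\<epsilon> > 0"
    then have "\<exists>\<^sub>F n in sequentially. real n powr (\<theta> - \<epsilon>) \<le> \<bar>f n\<bar>"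
      using assms by (auto simp: grows_def)
    moreover have "\<forall>\<^sub>F n in sequentially. n \<ge> (2::nat)" by (rule eventually_ge_at_top)
    ultimately have "\<exists>\<^sub>F n in sequentially. n \<ge> 2 \<and> real n powr (\<theta> - \<epsilon>) \<le> \<bar>f n\<bar>"
      by (rule frequently_eventually_conj)
    then have freq: "\<exists>\<^sub>F n in sequentially. ereal (\<theta> - \<epsilon>) \<le> ?r n"
    proof (rule frequently_elim1, elim conjE)
      fix n :: nat assume n: "n \<ge> 2" "real n powr (\<theta> - \<epsilon>) \<le> \<bar>f n\<bar>"
      have "real n powr (\<theta> - \<epsilon>) > 0" using n by simp
      then have nz: "f n \<noteq> 0" using n by auto
      have "ln (real n powr (\<theta> - \<epsilon>)) \<le> ln \<bar>f n\<bar>" using n nz by (subst ln_le_cancel_iff) auto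
      then have "\<theta> - \<epsilon> \<le> ln \<bar>f n\<bar> / ln n"
        using n quot(2)[of n] by (simp add: ln_powr field_simps)
      then show "ereal (\<theta> - \<epsilon>) \<le> ?r n" using quot[of n] n nz by auto
    qed
    have "ereal (\<theta> - \<epsilon>) \<le> growth_exp f"
    proof (rule ccontr)
      assume "\<not> ereal (\<theta> - \<epsilon>) \<le> growth_exp f"
      then have "\<forall>\<^sub>F n in sequentially. ?r n < ereal (\<theta> - \<epsilon>)"
        unfolding growth_exp_def by (intro Limsup_lessD) (simp add: not_le)
      then show False using freq by (auto simp: frequently_def not_le)
    qed
    then have "ereal (\<theta> - \<epsilon>) + ereal \<epsilon> \<le> growth_exp f + ereal \<epsilon>" by (intro add_right_mono)
    then show "ereal \<theta> \<le> growth_exp f + ereal \<epsilon>" by simp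
  qed
qed

text \<open>Serves the backward sums, which are forward sums with shifted index minus a
  constant.\<close>

lemma grows_shift:
  assumes f: "grows f \<theta>" and \<theta>: "\<theta> > 0" and g: "\<And>n. g n = f (n + k) - c"
  shows "grows g \<theta>"
  unfolding grows_def
proof (intro allI impI conjI)
  fix \<epsilon> :: real assume \<epsilon>: "\<epsilon> > 0"
  have "\<forall>\<^sub>F n in sequentially. \<bar>f n\<bar> \<le> real n powr (\<theta> + \<epsilon> / 2)"
    using f \<epsilon> by (simp add: grows_def)
  then have "\<forall>\<^sub>F n in sequentially. \<bar>f (n + k)\<bar> \<le> real (n + k) powr (\<theta> + \<epsilon> / 2)"
    by (subst eventually_sequentially_seg[of "\<lambda>n. \<bar>f n\<bar> \<le> real n powr (\<theta> + \<epsilon> / 2)"])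
  moreover have "\<forall>\<^sub>F n in sequentially. real (n + k) powr (\<theta> + \<epsilon> / 2) + \<bar>c\<bar> \<le> real n powr (\<theta> + \<epsilon>)"
    using \<epsilon> \<theta> by real_asymp
  ultimately show "\<forall>\<^sub>F n in sequentially. \<bar>g n\<bar> \<le> real n powr (\<theta> + \<epsilon>)"
    by eventually_elim (simp add: g)
  \<comment> \<open>Keeps the exponent \<open>\<theta> - \<delta>\<close> positive, so that the
    constant is of lower order.\<close>
  define \<delta> where "\<delta> = min \<epsilon> (\<theta> / 2)"
  have \<delta>: "\<delta> > 0" "\<delta> \<le> \<epsilon>" "\<theta> - \<delta> > 0" using \<epsilon> \<theta> by (auto simp: \<delta>_def min_def)
  have "\<forall>\<^sub>F n in sequentially. real n powr (\<theta> - \<delta>) + \<bar>c\<bar> \<le> real (n + k) powr (\<theta> - \<delta> / 2)"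
    using \<delta> by real_asymp
  then obtain N where N: "\<And>n. n \<ge> N \<Longrightarrow> real n powr (\<theta> - \<delta>) + \<bar>c\<bar> \<le> real (n + k) powr (\<theta> - \<delta> / 2)"
    by (auto simp: eventually_sequentially)
  show "\<exists>\<^sub>F n in sequentially. real n powr (\<theta> - \<epsilon>) \<le> \<bar>g n\<bar>"
    unfolding frequently_sequentially
  proof
    fix M
    have "\<exists>\<^sub>F n in sequentially. real n powr (\<theta> - \<delta> / 2) \<le> \<bar>f n\<bar>"
      using f \<delta> by (simp add: grows_def)
    then obtain m where m: "m \<ge> M + N + k + 1" "real m powr (\<theta> - \<delta> / 2) \<le> \<bar>f m\<bar>"
      unfolding frequently_sequentially by blast
    define n where "n = m - k"
    have n: "m = n + k" "n \<ge> M" "n \<ge> N" "n \<ge> 1" using m by (auto simp: n_def)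
    have "real n powr (\<theta> - \<epsilon>) \<le> real n powr (\<theta> - \<delta>)" using n \<delta> by (intro powr_mono) auto
    then have "real n powr (\<theta> - \<epsilon>) \<le> \<bar>g n\<bar>" using N[of n] m n by (simp add: g)
    then show "\<exists>n\<ge>M. real n powr (\<theta> - \<epsilon>) \<le> \<bar>g n\<bar>" using n by blast
  qed
qed

lemma abs_mean_add_le:
  fixes h h' d l l' A A' R :: real
  assumes "\<bar>h\<bar> \<le> l" "\<bar>h'\<bar> \<le> l'" "l \<le> A" "l' \<le> A'" "A' + A + \<bar>d\<bar> \<le> R"
  shows "\<bar>(h + h') / 2 + d\<bar> \<le> R"
proof -
  have "h \<le> l" "- h \<le> l" "h' \<le> l'" "- h' \<le> l'" using assms(1,2) by (simp_all add: abs_le_iff)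
  moreover have "d \<le> \<bar>d\<bar>" "- d \<le> \<bar>d\<bar>" by auto
  ultimately show ?thesis using assms(3-5) by (intro abs_leI) (simp_all add: field_simps)
qed

text \<open>Gives the Farey neighbour \<open>v / u\<close> below \<open>P / Q\<close>, by reducing a
  Bezout coefficient modulo \<open>Q\<close> to the range from 1 to \<open>Q\<close>.\<close>

lemma coprime_complement:
  fixes P Q :: int
  assumes "coprime P Q" "P \<ge> 1" "Q \<ge> 1"
  obtains u v where "u * P - v * Q = 1" "1 \<le> u" "u \<le> Q" "0 \<le> v"
proof -
  obtain x z where xz: "x * P + z * Q = 1" using bezout_int[of P Q] assms by auto
  define u where "u = (x - 1) mod Q + 1"
  define v where "v = - z - (x - 1) div Q * P"
  have "0 \<le> (x - 1) mod Q" "(x - 1) mod Q < Q" using assms by auto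
  then have u: "1 \<le> u" "u \<le> Q" unfolding u_def by linarith+
  have ux: "u = x - (x - 1) div Q * Q" by (simp add: u_def minus_div_mult_eq_mod[symmetric])
  have "u * P - v * Q = x * P + z * Q" unfolding ux v_def by (simp add: algebra_simps)
  then have uv: "u * P - v * Q = 1" using xz by simp
  have "1 * 1 \<le> u * P" using u assms by (intro mult_mono) auto
  then have "v * Q \<ge> 0" using uv by linarith
  then have "v \<ge> 0" using assms by (simp add: zero_le_mult_iff)
  then show ?thesis using that u uv by blast
qed

section \<open>Visits to given fractions and large sums\<close>

context bcz_orbit
begin

text \<open>Between the times \<open>t n\<close> and \<open>t (Suc n)\<close> enclosing
  \<open>Q / L\<close>, the vector \<open>(Q, P)\<close> is a nonnegative combination of two
  consecutive orbit vectors. Both cannot occur, as \<open>y n + y (Suc n) > 1 \<ge> L\<close>, and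
  primitivity makes the coefficient 1.\<close>

lemma orbit_contains:
  assumes "coprime P Q" "Q \<ge> 1" "P \<ge> 0" "Q * b - P * a > 0" "Q * b - P * a \<le> 1"
  shows "\<exists>n. q n = Q \<and> p n = P"
proof -
  define L where "L = Q * b - P * a"
  have L: "L > 0" "L \<le> 1" using assms by (auto simp: L_def)
  obtain m :: nat where "real m > Q / L / a" using reals_Archimedean2 by blast
  then have "a * (Q / L / a) < a * m" using ab by (intro mult_strict_left_mono)
  then have "Q / L < a * m" using ab by simp
  then have "t m > Q / L" using index_le_t[of m] by linarith
  then have ex: "\<exists>m. t m > Q / L" by blast
  define N where "N = (LEAST m. t m > Q / L)"
  have tN: "t N > Q / L" unfolding N_def by (rule LeastI_ex[OF ex])
  have "P * a \<ge> 0" using assms ab by simp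
  then have "t 0 \<le> Q / L" using L ab by (simp add: t_0 L_def field_simps)
  then obtain n where n: "N = Suc n" using tN by (cases N) auto
  have tn: "t n \<le> Q / L" using not_less_Least[of n "\<lambda>m. t m > Q / L"] n by (simp add: N_def)
  define \<alpha> \<beta> where "\<alpha> = Q * p (Suc n) - P * q (Suc n)" and "\<beta> = q n * P - p n * Q"
  have Q: "Q = \<alpha> * q n + \<beta> * q (Suc n)"
  proof -
    have "\<alpha> * q n + \<beta> * q (Suc n) = Q * (q n * p (Suc n) - p n * q (Suc n))"
      by (simp add: \<alpha>_def \<beta>_def algebra_simps)
    then show ?thesis by (simp add: det_qp)
  qed
  have P: "P = \<alpha> * p n + \<beta> * p (Suc n)"
  proof -
    have "\<alpha> * p n + \<beta> * p (Suc n) = P * (q n * p (Suc n) - p n * q (Suc n))"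
      by (simp add: \<alpha>_def \<beta>_def algebra_simps)
    then show ?thesis by (simp add: det_qp)
  qed
  have "a * \<alpha> = L * q (Suc n) - Q * y (Suc n)"
    by (simp add: \<alpha>_def L_def y_eq algebra_simps)
  moreover have "L * q (Suc n) - Q * y (Suc n) > 0"
    using tN L y_bounds[of "Suc n"] unfolding n t_def by (simp add: field_simps)
  ultimately have "a * \<alpha> > 0" by linarith
  then have \<alpha>: "\<alpha> \<ge> 1" using ab by (simp add: zero_less_mult_iff)
  have "a * \<beta> = Q * y n - L * q n" by (simp add: \<beta>_def L_def y_eq algebra_simps)
  moreover have "Q * y n - L * q n \<ge> 0"
    using tn L y_bounds[of n] unfolding t_def by (simp add: field_simps)
  ultimately have "a * \<beta> \<ge> 0" by linarith
  then have \<beta>: "\<beta> \<ge> 0" using ab by (simp add: zero_le_mult_iff)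
  have Lab: "L = \<alpha> * y n + \<beta> * y (Suc n)"
    by (simp add: L_def Q P y_eq algebra_simps)
  have "\<beta> = 0"
  proof (rule ccontr)
    assume "\<beta> \<noteq> 0"
    then have "1 * y n + 1 * y (Suc n) \<le> \<alpha> * y n + \<beta> * y (Suc n)"
      using \<alpha> \<beta> y_bounds[of n] y_bounds[of "Suc n"] by (intro add_mono mult_right_mono) auto
    then show False using Lab L y_bounds(3)[of n] by simp
  qed
  then have "\<alpha> dvd P" "\<alpha> dvd Q" by (auto simp: P Q)
  then have "is_unit \<alpha>" using \<open>coprime P Q\<close> by (metis coprime_common_divisor)
  then have "\<alpha> = 1" using \<alpha> by auto
  then show ?thesis using P Q \<open>\<beta> = 0\<close> by auto
qed

text \<open>A good lower fraction is visited at some index \<open>i\<close> with a digit of order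
  \<open>Y = 1 / y i\<close>. Consecutive sums then differ by about \<open>Y / 2\<close>, so one of
  them is large, while \<open>a * i \<le> t i = Y * Q\<close> bounds the index by a multiple of
  \<open>Y powr (v / (v - 1))\<close>.\<close>

lemma f_hat_frequently_odd:
  fixes v \<rho> :: real
  assumes v: "v > 1" and \<rho>: "\<rho> > 0" "\<rho> < (v - 1) / v"
    and approx: "\<And>N. \<exists>P Q :: int. real_of_int Q \<ge> N \<and> Q \<ge> 1 \<and> P \<ge> 0 \<and> coprime P Q \<and>
      Q * b - P * a > 0 \<and> Q * b - P * a \<le> Q powr (1 - v)"
  shows "\<exists>\<^sub>F n in sequentially. real n powr \<rho> \<le> \<bar>f_hat (a, b) n\<bar>"
  unfolding frequently_sequentially
proof
  fix N :: nat
  obtain C where C: "C \<ge> 1" "\<And>n. 1 / y n \<le> C * (real n + 1)" using inverse_y_bound by blast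
  define A \<tau> where "A = (3 / a) powr \<rho>" and "\<tau> = v / (v - 1) * \<rho>"
  have A: "A > 0" using ab by (simp add: A_def)
  have \<tau>: "\<tau> < 1" using \<rho> v by (simp add: \<tau>_def field_simps)
  have "\<forall>\<^sub>F Y in at_top. A * Y powr \<tau> \<le> Y / 4 - 2" using A \<tau> by real_asymp
  then obtain Y0 where Y0: "\<And>Y. Y \<ge> Y0 \<Longrightarrow> A * Y powr \<tau> \<le> Y / 4 - 2"
    by (auto simp: eventually_at_top_linorder)
  \<comment> \<open>\<open>Y0\<close> serves the asymptotic comparison; the last entry forces the
    index to be at least \<open>N\<close> through \<open>inverse_y_bound\<close>.\<close>
  define Y1 where "Y1 = max 1 (max Y0 (C * (real N + 1)))"
  obtain P Q :: int where Q: "real_of_int Q \<ge> Y1 powr (1 / (v - 1))" "Q \<ge> 1" "P \<ge> 0" "coprime P Q"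
    "Q * b - P * a > 0" "Q * b - P * a \<le> Q powr (1 - v)" using approx by blast
  have "real_of_int Q powr (1 - v) \<le> real_of_int Q powr 0" using Q v by (intro powr_mono) auto
  then have "Q * b - P * a \<le> 1" using Q by simp
  then obtain i where i: "q i = Q" "p i = P" using orbit_contains Q by blast
  define Y where "Y = 1 / y i"
  have yi: "y i > 0" "y i = Q * b - P * a" using y_bounds y_eq i by auto
  have QY: "Q powr (v - 1) \<le> Y"
  proof -
    have "y i * Q powr (v - 1) \<le> Q powr (1 - v) * Q powr (v - 1)"
      using Q yi by (intro mult_right_mono) auto
    also have "\<dots> = 1" using Q by (simp add: powr_add[symmetric])
    finally show ?thesis using yi(1) by (simp add: Y_def field_simps)
  qed
  have "Y1 = (Y1 powr (1 / (v - 1))) powr (v - 1)" using v by (simp add: powr_powr Y1_def)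
  also have "\<dots> \<le> Q powr (v - 1)" using Q v by (intro powr_mono2) auto
  finally have Y1: "Y1 \<le> Y" using QY by linarith
  then have Y: "Y \<ge> 1" "Y \<ge> Y0" "Y \<ge> C * (real N + 1)" by (auto simp: Y1_def)
  have "C * (real N + 1) \<le> C * (real i + 1)" using C(2)[of i] Y by (simp add: Y_def)
  then have Ni: "N \<le> i" using C(1) by simp
  have "f_hat (a, b) (Suc (Suc i)) - f_hat (a, b) (Suc i) = (real_of_int (K i) + K (Suc i)) / 2 - 3"
    by (simp add: f_hat_eq height_word field_simps)
  moreover have "Y < K i + 1" "K (Suc i) \<ge> 1" using K_bounds[of i] K_bounds[of "Suc i"] by (auto simp: Y_def)
  ultimately have "f_hat (a, b) (Suc (Suc i)) - f_hat (a, b) (Suc i) \<ge> Y / 2 - 3" by simp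
  then have "\<not> (\<bar>f_hat (a, b) (Suc i)\<bar> < Y / 4 - 2 \<and> \<bar>f_hat (a, b) (Suc (Suc i))\<bar> < Y / 4 - 2)"
    by (auto simp: abs_less_iff)
  then obtain n where n: "n = Suc i \<or> n = Suc (Suc i)" "\<bar>f_hat (a, b) n\<bar> \<ge> Y / 4 - 2"
    by (auto simp: not_less)
  have "Q = (Q powr (v - 1)) powr (1 / (v - 1))" using Q v by (simp add: powr_powr)
  also have "\<dots> \<le> Y powr (1 / (v - 1))" using QY v by (intro powr_mono2) auto
  finally have QY': "Q \<le> Y powr (1 / (v - 1))" .
  have "Y powr (v / (v - 1)) = Y powr (1 + 1 / (v - 1))" using v by (simp add: field_simps)
  also have "\<dots> = Y * Y powr (1 / (v - 1))" using Y by (simp add: powr_add)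
  finally have YY: "Y * Y powr (1 / (v - 1)) = Y powr (v / (v - 1))" by simp
  have "a * i \<le> Y * Q" using index_le_t[of i] i by (simp add: t_def Y_def)
  also have "\<dots> \<le> Y * Y powr (1 / (v - 1))" using QY' Y by (intro mult_left_mono) auto
  finally have ai: "a * i \<le> Y powr (v / (v - 1))" by (simp only: YY)
  have "Y powr (v / (v - 1)) \<ge> 1" using Y v by (intro ge_one_powr_ge_zero) auto
  then have "a * n \<le> 3 * Y powr (v / (v - 1))" using n(1) ai ab by (auto simp: algebra_simps)
  then have "n \<le> 3 / a * Y powr (v / (v - 1))" using ab by (simp add: field_simps)
  then have "n powr \<rho> \<le> (3 / a * Y powr (v / (v - 1))) powr \<rho>" using \<rho> by (intro powr_mono2) auto
  also have "\<dots> = (3 / a) powr \<rho> * (Y powr (v / (v - 1))) powr \<rho>" by (rule powr_mult)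
  also have "\<dots> = A * Y powr \<tau>" by (simp add: A_def \<tau>_def powr_powr)
  also have "\<dots> \<le> \<bar>f_hat (a, b) n\<bar>" using Y0 Y n by fastforce
  finally have "real n powr \<rho> \<le> \<bar>f_hat (a, b) n\<bar>" .
  moreover have "N \<le> n" using n(1) Ni by auto
  ultimately show "\<exists>n\<ge>N. real n powr \<rho> \<le> \<bar>f_hat (a, b) n\<bar>" by blast
qed

text \<open>Near a fraction \<open>P / Q\<close> slightly above \<open>b / a\<close>, the orbit visits the vectors \<open>u + i g\<close> with
  \<open>g = (Q, P)\<close>, and at these visits the height decreases with \<open>i\<close> up to an error of order \<open>Q\<close>.\<close>

lemma visits_near_upper_fraction:
  fixes P Q :: int
  assumes PQ: "coprime P Q" "Q \<ge> 1" "P * a - Q * b > 0" and "4 * Q * (P * a - Q * b) \<le> a"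
  shows "\<exists>h. \<forall>i::nat. 4 * i * Q * (P * a - Q * b) \<le> a \<longrightarrow>
    (\<exists>m. \<bar>f_hat (a, b) (Suc m) - (h - real i)\<bar> \<le> 6 * Q / a \<and> Q \<le> 1 / y m
       \<and> a * a * m \<le> 2 * (real i + 1) * (real_of_int Q)\<^sup>2)"
proof -
  define \<delta> where "\<delta> = P * a - Q * b"
  have \<delta>: "\<delta> > 0" "4 * Q * \<delta> \<le> a" using assms by (auto simp: \<delta>_def)
  have "real_of_int P * a > Q * b" using PQ by simp
  moreover have "Q * b > 0" using PQ ab by simp
  ultimately have "P \<ge> 1" using ab by (smt (verit) mult_nonpos_nonneg of_int_le_0_iff)
  then obtain u v where uv: "u * P - v * Q = 1" "1 \<le> u" "u \<le> Q" "0 \<le> v"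
    using coprime_complement PQ by blast
  \<comment> \<open>\<open>X\<close> is the address of the interval from \<open>v / u\<close> to
    \<open>P / Q\<close>.\<close>
  obtain X where X: "left_val 1 0 X = u" "right_val 1 0 X = Q" "left_val 0 1 X = v" "right_val 0 1 X = P"
    using word_exists[of u P v Q] uv \<open>P \<ge> 1\<close> PQ by auto
  define l where "l = u * b - v * a"
  have Ql: "Q * l + u * \<delta> = a"
  proof -
    have "Q * l + u * \<delta> = of_int (u * P - v * Q) * a" by (simp add: l_def \<delta>_def algebra_simps)
    then show ?thesis by (simp add: uv)
  qed
  have u\<delta>: "0 \<le> u * \<delta>" "u * \<delta> \<le> Q * \<delta>" using uv \<delta> by (auto intro!: mult_right_mono)
  define h where "h = real_of_int (height X) + itinerary (b, a) / 2 - 3"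
  have "\<exists>m. \<bar>f_hat (a, b) (Suc m) - (h - real i)\<bar> \<le> 6 * Q / a \<and> Q \<le> 1 / y m
      \<and> a * a * m \<le> 2 * (real i + 1) * (real_of_int Q)\<^sup>2"
    if i: "4 * i * Q * \<delta> \<le> a" for i :: nat
  proof -
    define U V where "U = u + i * Q" and "V = v + i * P"
    have UV: "U * P - V * Q = 1" using uv(1) by (simp add: U_def V_def algebra_simps)
    have cop: "coprime V U"
    proof (rule coprimeI)
      fix c assume "c dvd V" "c dvd U"
      then have "c dvd U * P - V * Q" by simp
      then show "is_unit c" by (simp add: UV)
    qed
    have U: "U \<ge> 1" "V \<ge> 0" using uv PQ \<open>P \<ge> 1\<close> by (auto simp: U_def V_def add_increasing2)
    define z where "z = U * b - V * a"
    have z: "z = l - i * \<delta>" by (simp add: z_def U_def V_def l_def \<delta>_def algebra_simps)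
    have Qz: "Q * z = a - u * \<delta> - i * (Q * \<delta>)" using Ql by (simp add: z algebra_simps)
    have "i * (Q * \<delta>) \<ge> 0" using PQ \<delta> by simp
    moreover have "4 * (i * (Q * \<delta>)) \<le> a" "4 * (Q * \<delta>) \<le> a" using i \<delta> by (simp_all add: mult.assoc)
    \<comment> \<open>The condition on \<open>i\<close> keeps \<open>z\<close> between
      \<open>a / (2 * Q)\<close> and \<open>a / Q\<close>, so the vector \<open>(U, V)\<close> is
      visited.\<close>
    ultimately have Qz': "Q * z \<le> a" "a \<le> 2 * (Q * z)" using Qz u\<delta> by linarith+
    then have "Q * z > 0" using ab by linarith
    then have z0: "z > 0" using PQ by (simp add: zero_less_mult_iff)
    then have "1 * z \<le> Q * z" using PQ by (intro mult_right_mono) auto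
    then have "z \<le> 1" using Qz' ab by linarith
    then obtain m where m: "q m = U" "p m = V"
      using orbit_contains[of V U] cop U z0 by (auto simp: z_def)
    have ym: "y m = z" using y_eq[of m] m by (simp add: z_def)
    have iz: "1 / z \<le> 2 * Q / a" using Qz' z0 ab by (simp add: field_simps)
    \<comment> \<open>\<open>(q (Suc m), p (Suc m))\<close> and \<open>(Q, P)\<close> both have
      determinant 1 with the primitive vector \<open>(U, V)\<close>, so they differ by a multiple
      \<open>k\<close> of it.\<close>
    have "U * (p (Suc m) - P) = V * (q (Suc m) - Q)"
      using det_qp[of m] UV m by (simp add: algebra_simps)
    moreover from this have "U dvd q (Suc m) - Q"
      using cop by (metis coprime_commute coprime_dvd_mult_right_iff dvd_triv_left)
    ultimately obtain k where k: "q (Suc m) - Q = U * k" "p (Suc m) - P = V * k"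
      using U by (auto elim!: dvdE)
    have "y (Suc m) = k * z - \<delta>"
    proof -
      have "q (Suc m) = Q + U * k" "p (Suc m) = P + V * k" using k by auto
      then show ?thesis using y_eq[of "Suc m"] by (simp add: z_def \<delta>_def algebra_simps)
    qed
    then have kz: "k * z > 0" "k * z \<le> 1 + \<delta>" using y_bounds[of "Suc m"] \<delta> by auto
    have "1 * \<delta> \<le> Q * \<delta>" using PQ \<delta> by (intro mult_right_mono) auto
    moreover have "4 * (Q * \<delta>) \<le> a" using \<delta> by (simp add: mult.assoc)
    ultimately have "\<delta> \<le> 1" using \<delta> ab by linarith
    have k0: "k > 0" using kz z0 by (simp add: zero_less_mult_iff)
    have "k * z \<le> 2" using kz \<open>\<delta> \<le> 1\<close> by simp
    then have "k \<le> 2 * (1 / z)" using z0 by (simp add: field_simps)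
    then have k4: "k \<le> 4 * Q / a" using iz by simp
    \<comment> \<open>After \<open>X\<close> the address goes \<open>i\<close> times right, towards
      \<open>P / Q\<close>, and then \<open>k\<close> times left, with \<open>k\<close> at most of
      order \<open>Q\<close>.\<close>
    have "word m = replicate (nat k) True @ replicate i False @ X"
    proof (rule word_inject)
      have n: "int (nat k) = k" using k0 by simp
      show "left_val 1 0 (word m) = left_val (1::int) 0 (replicate (nat k) True @ replicate i False @ X)"
        "left_val 0 1 (word m) = left_val (0::int) 1 (replicate (nat k) True @ replicate i False @ X)"
        using m unfolding val_append val_replicate X U_def V_def
        by (simp_all add: q_def p_def)
      show "right_val 1 0 (word m) = right_val (1::int) 0 (replicate (nat k) True @ replicate i False @ X)"
        "right_val 0 1 (word m) = right_val (0::int) 1 (replicate (nat k) True @ replicate i False @ X)"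
        using k n unfolding val_append val_replicate X U_def V_def right_val_word
        by (simp_all add: q_def p_def algebra_simps)
    qed
    then have "height (word m) = k - int i + height X" using k0 by simp
    then have "f_hat (a, b) (Suc m) - (h - real i) = k - K m / 2"
      by (simp add: f_hat_eq h_def)
    moreover have "K m \<le> 4 * Q / a" using K_bounds(3)[of m] iz by (simp add: ym)
    moreover have "K m \<ge> 1" using K_bounds(1) .
    ultimately have "\<bar>f_hat (a, b) (Suc m) - (h - real i)\<bar> \<le> 6 * Q / a"
      using k4 k0 PQ ab by (auto simp: abs_le_iff add_divide_distrib)
    moreover have "Q \<le> 1 / y m" using Qz' z0 ab by (simp add: ym field_simps)
    moreover have "a * a * m \<le> 2 * (real i + 1) * (real_of_int Q)\<^sup>2"
    proof -
      have "real_of_int U \<le> (real i + 1) * Q" using uv(3) by (simp add: U_def algebra_simps)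
      have "a * m \<le> U * (1 / z)" using index_le_t[of m] m by (simp add: t_def ym)
      also have "\<dots> \<le> ((real i + 1) * Q) * (2 * Q / a)"
        using iz z0 \<open>real_of_int U \<le> _\<close> PQ by (intro mult_mono) auto
      finally show ?thesis using ab by (simp add: field_simps power2_eq_square)
    qed
    ultimately show ?thesis by blast
  qed
  then show ?thesis unfolding \<delta>_def by blast
qed

text \<open>The visits \<open>i = 0\<close> and \<open>i = I\<close> have sums differing by
  \<open>I\<close>, of order \<open>Q powr (v - 2)\<close>, up to an error \<open>O(Q)\<close>,
  which is of lower order. So one sum is large, and both indices are
  \<open>O(Q powr v)\<close>.\<close>

lemma f_hat_frequently_even:
  fixes v \<rho> :: real
  assumes v: "v > 4" and \<rho>: "\<rho> > 0" "\<rho> < (v - 2) / v"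
    and approx: "\<And>N. \<exists>P Q :: int. real_of_int Q \<ge> N \<and> Q \<ge> 1 \<and> coprime P Q \<and>
      P * a - Q * b > 0 \<and> P * a - Q * b \<le> a * Q powr (1 - v)"
  shows "\<exists>\<^sub>F n in sequentially. real n powr \<rho> \<le> \<bar>f_hat (a, b) n\<bar>"
  unfolding frequently_sequentially
proof
  fix N :: nat
  obtain C where C: "C \<ge> 1" "\<And>n. 1 / y n \<le> C * (real n + 1)" using inverse_y_bound by blast
  define A \<tau> B where "A = (3 / (a * a)) powr \<rho>" and "\<tau> = v * \<rho>" and "B = 6 / a"
  have A: "A > 0" "B > 0" using ab by (auto simp: A_def B_def)
  have \<tau>: "\<tau> < v - 2" using \<rho> v by (simp add: \<tau>_def field_simps)
  have "\<forall>\<^sub>F x in at_top. A * x powr \<tau> \<le> x powr (v - 2) / 8 - 1 / 2 - B * x" using A \<tau> v by real_asymp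
  then obtain x0 where x0: "\<And>x. x \<ge> x0 \<Longrightarrow> A * x powr \<tau> \<le> x powr (v - 2) / 8 - 1 / 2 - B * x"
    by (auto simp: eventually_at_top_linorder)
  obtain P Q :: int where Q: "real_of_int Q \<ge> max 2 (max x0 (C * (real N + 1)))" "Q \<ge> 1" "coprime P Q"
    "P * a - Q * b > 0" "P * a - Q * b \<le> a * Q powr (1 - v)" using approx by blast
  define x where "x = real_of_int Q"
  have x: "x \<ge> 2" "x \<ge> x0" "x \<ge> C * (real N + 1)" using Q by (auto simp: x_def)
  define \<delta> where "\<delta> = P * a - Q * b"
  have \<delta>: "\<delta> > 0" "\<delta> \<le> a * x powr (1 - v)" using Q by (auto simp: \<delta>_def x_def)
  have "x powr 2 \<le> x powr (v - 2)" using x v by (intro powr_mono) auto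
  moreover have "2 * 2 \<le> x * x" using x by (intro mult_mono) auto
  ultimately have x4: "x powr (v - 2) \<ge> 4" using x by (simp add: power2_eq_square)
  \<comment> \<open>Essentially the largest \<open>i\<close> for which the visit is
    guaranteed.\<close>
  define I where "I = nat \<lfloor>x powr (v - 2) / 4\<rfloor>"
  have I: "real I \<le> x powr (v - 2) / 4" "real I \<ge> x powr (v - 2) / 4 - 1" "I \<ge> 1"
    using x4 unfolding I_def by linarith+
  have "x * \<delta> \<le> x * (a * x powr (1 - v))" using \<delta> x by (intro mult_left_mono) auto
  also have "\<dots> = a * x powr (2 - v)" using x by (simp add: powr_diff power2_eq_square)
  finally have x\<delta>: "x * \<delta> \<le> a * x powr (2 - v)" .
  have "4 * I * (x * \<delta>) \<le> x powr (v - 2) * (a * x powr (2 - v))"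
    by (rule mult_mono) (use I x\<delta> x \<delta> in auto)
  also have "\<dots> = a * (x powr (v - 2) * x powr (2 - v))" by simp
  also have "\<dots> = a" using x by (simp flip: powr_add)
  finally have I4: "4 * I * (x * \<delta>) \<le> a" .
  have "x * \<delta> \<ge> 0" using x \<delta> by simp
  then have "4 * 1 * (x * \<delta>) \<le> 4 * I * (x * \<delta>)" using I(3) by (intro mult_right_mono) auto
  then have "4 * (x * \<delta>) \<le> a" using I4 by simp
  then have "4 * Q * (P * a - Q * b) \<le> a" by (simp add: x_def \<delta>_def mult.assoc)
  from visits_near_upper_fraction[OF Q(3,2,4) this] obtain h where
    h: "\<And>i::nat. 4 * i * Q * (P * a - Q * b) \<le> a \<Longrightarrow>
    (\<exists>m. \<bar>f_hat (a, b) (Suc m) - (h - real i)\<bar> \<le> 6 * Q / a \<and> Q \<le> 1 / y m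
       \<and> a * a * m \<le> 2 * (real i + 1) * (real_of_int Q)\<^sup>2)" by blast
  obtain m0 where m0: "\<bar>f_hat (a, b) (Suc m0) - h\<bar> \<le> B * x" "x \<le> 1 / y m0"
      "a * a * m0 \<le> 2 * (real I + 1) * x\<^sup>2"
  proof -
    have "2 * (real 0 + 1) * x\<^sup>2 \<le> 2 * (real I + 1) * x\<^sup>2" by (intro mult_right_mono) auto
    then show ?thesis using h[of 0] ab that by (fastforce simp: x_def B_def)
  qed
  obtain m1 where m1: "\<bar>f_hat (a, b) (Suc m1) - (h - I)\<bar> \<le> B * x" "x \<le> 1 / y m1"
      "a * a * m1 \<le> 2 * (real I + 1) * x\<^sup>2"
    using h[of I] I4 by (auto simp: x_def B_def \<delta>_def mult.assoc)
  have "\<exists>m. (m = m0 \<or> m = m1) \<and> \<bar>f_hat (a, b) (Suc m)\<bar> \<ge> I / 2 - B * x"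
  proof (rule ccontr)
    assume "\<not> ?thesis"
    then have "\<bar>f_hat (a, b) (Suc m0)\<bar> < I / 2 - B * x" "\<bar>f_hat (a, b) (Suc m1)\<bar> < I / 2 - B * x"
      by auto
    then show False using m0(1) m1(1) by (auto simp: abs_le_iff abs_less_iff)
  qed
  then obtain m where m: "\<bar>f_hat (a, b) (Suc m)\<bar> \<ge> I / 2 - B * x" "x \<le> 1 / y m"
    "a * a * m \<le> 2 * (real I + 1) * x\<^sup>2" using m0 m1 by blast
  have "C * (real N + 1) \<le> C * (real m + 1)" using C(2)[of m] x m by linarith
  then have "N \<le> m" using C(1) by simp
  have "a * a * m \<le> 2 * (x powr (v - 2)) * x\<^sup>2"
    using m(3) I x4 by (elim order_trans) (intro mult_right_mono, auto)
  also have "\<dots> = 2 * x powr v" using x by (simp add: powr_diff)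
  finally have "a * a * m \<le> 2 * x powr v" .
  moreover have "a * a \<le> x powr v"
  proof -
    have "a * a \<le> 1 * 1" using ab by (intro mult_mono) auto
    also have "\<dots> \<le> x powr v" using x v by (simp add: ge_one_powr_ge_zero)
    finally show ?thesis .
  qed
  ultimately have "a * a * Suc m \<le> 3 * x powr v" by (simp add: algebra_simps)
  then have "Suc m \<le> 3 / (a * a) * x powr v" using ab by (simp add: field_simps)
  then have "Suc m powr \<rho> \<le> (3 / (a * a) * x powr v) powr \<rho>" using \<rho> by (intro powr_mono2) auto
  also have "\<dots> = (3 / (a * a)) powr \<rho> * (x powr v) powr \<rho>" by (rule powr_mult)
  also have "\<dots> = A * x powr \<tau>" by (simp add: A_def \<tau>_def powr_powr)
  also have "\<dots> \<le> x powr (v - 2) / 8 - 1 / 2 - B * x" using x0 x by blast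
  also have "\<dots> \<le> \<bar>f_hat (a, b) (Suc m)\<bar>" using m(1) I by simp
  finally show "\<exists>n\<ge>N. real n powr \<rho> \<le> \<bar>f_hat (a, b) n\<bar>"
    using \<open>N \<le> m\<close> by (intro exI[of _ "Suc m"]) auto
qed

text \<open>Writing the last digit as a difference of heights turns \<open>f_hat_eq\<close> into the
  mean of two consecutive heights plus a constant.\<close>

lemma f_hat_upper:
  assumes "\<And>\<epsilon>. \<epsilon> > 0 \<Longrightarrow> \<forall>\<^sub>F n in sequentially. length (word n) \<le> real n powr (\<theta> + \<epsilon>)"
    and "\<theta> > 0" and "\<epsilon> > 0"
  shows "\<forall>\<^sub>F n in sequentially. \<bar>f_hat (a, b) n\<bar> \<le> real n powr (\<theta> + \<epsilon>)"
proof -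
  define c where "c = \<bar>itinerary (b, a) / 2 - 9 / 2\<bar>"
  have len: "\<forall>\<^sub>F n in sequentially. length (word n) \<le> real n powr (\<theta> + \<epsilon> / 2)" using assms by simp
  then have "\<forall>\<^sub>F n in sequentially. length (word (Suc n)) \<le> real (Suc n) powr (\<theta> + \<epsilon> / 2)"
    by (subst eventually_sequentially_Suc[of "\<lambda>n. length (word n) \<le> real n powr (\<theta> + \<epsilon> / 2)"])
  moreover note len
  moreover have "\<forall>\<^sub>F n in sequentially. real n powr (\<theta> + \<epsilon> / 2) + real (Suc n) powr (\<theta> + \<epsilon> / 2) + c
    \<le> real (Suc (Suc n)) powr (\<theta> + \<epsilon>)" using assms by real_asymp
  ultimately have "\<forall>\<^sub>F n in sequentially. \<bar>f_hat (a, b) (Suc (Suc n))\<bar> \<le> real (Suc (Suc n)) powr (\<theta> + \<epsilon>)"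
  proof eventually_elim
    case (elim n)
    have "K (Suc n) = height (word (Suc n)) - height (word n) + 3" by (simp add: height_word)
    then have eq: "f_hat (a, b) (Suc (Suc n)) =
        (real_of_int (height (word (Suc n))) + height (word n)) / 2 + (itinerary (b, a) / 2 - 9 / 2)"
      by (simp add: f_hat_eq field_simps)
    have h: "\<bar>real_of_int (height (word m))\<bar> \<le> length (word m)" for m
      using abs_height_le[of "word m"] by linarith
    show ?case
      unfolding eq by (rule abs_mean_add_le[OF h h elim(1,2)]) (use elim(3) in \<open>simp add: c_def\<close>)
  qed
  then show ?thesis
    using eventually_sequentially_Suc[of "\<lambda>n. \<bar>f_hat (a, b) n\<bar> \<le> real n powr (\<theta> + \<epsilon>)"]
      eventually_sequentially_Suc[of "\<lambda>n. \<bar>f_hat (a, b) (Suc n)\<bar> \<le> real (Suc n) powr (\<theta> + \<epsilon>)"]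
    by blast
qed

end

section \<open>Diophantine exponents\<close>

lemma denom_pos: "denom r > 0"
  by (simp add: denom_def quotient_of_denom_pos')

lemma of_rat_denom:
  obtains n where "of_rat r = real_of_int n / denom r" "coprime n (denom r)" "quotient_of r = (n, denom r)"
proof -
  obtain n d where nd: "quotient_of r = (n, d)" by fastforce
  then have "r = of_int n / of_int d" "coprime n d"
    using quotient_of_div quotient_of_coprime by auto
  then show ?thesis using that[of n] nd by (simp add: denom_def of_rat_divide)
qed

lemma quotient_of_Fract:
  assumes "coprime P Q" "Q > 0"
  shows "quotient_of (Fract P Q) = (P, Q)"
  using assms by (simp add: quotient_of_Fract normalize_def)

lemma denom_Fract: "coprime P Q \<Longrightarrow> Q > 0 \<Longrightarrow> denom (Fract P Q) = Q"
  by (simp add: denom_def quotient_of_Fract)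

lemma of_rat_Fract: "Q > 0 \<Longrightarrow> of_rat (Fract P Q) = real_of_int P / of_int Q"
  by (simp add: of_rat_rat)

lemma denom_le:
  assumes "Q > 0" "of_rat r = real_of_int P / of_int Q"
  shows "denom r \<le> Q"
proof -
  obtain n where n: "of_rat r = real_of_int n / denom r" "coprime n (denom r)" by (rule of_rat_denom)
  have "real_of_int n * Q = real_of_int P * denom r"
    using n(1) assms denom_pos[of r] by (simp add: field_simps)
  then have "n * Q = P * denom r" by (simp only: of_int_mult[symmetric] of_int_eq_iff)
  then have "denom r dvd n * Q" by simp
  then have "denom r dvd Q" using n(2) by (simp add: coprime_dvd_mult_right_iff coprime_commute)
  then show ?thesis using assms(1) by (intro zdvd_imp_le)
qed

lemma denom_uminus: "denom (- r) = denom r"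
  by (simp add: denom_def rat_uminus_code Let_def split: prod.splits)

text \<open>The denominator of the reciprocal is the numerator of \<open>r\<close>.\<close>

lemma denom_inverse:
  assumes "r > 0"
  shows "denom (inverse r) = of_rat r * denom r"
proof -
  obtain n where n: "of_rat r = real_of_int n / denom r" "coprime n (denom r)" "quotient_of r = (n, denom r)"
    by (rule of_rat_denom)
  have "n > 0" using assms n(3) quotient_of_div zero_less_divide_iff denom_pos[of r]
    by (metis of_int_0_less_iff less_asym)
  have "inverse r = Fract (denom r) n"
    by (subst quotient_of_div[OF n(3)]) (simp add: Fract_of_int_quotient)
  then have "denom (inverse r) = n" using n \<open>n > 0\<close> by (simp add: denom_Fract coprime_commute)
  then show ?thesis using n(1) denom_pos[of r] by simp
qed

lemma finite_denom_le:
  fixes s N :: real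
  shows "finite {r. \<bar>s - of_rat r\<bar> \<le> 1 \<and> real_of_int (denom r) \<le> N}" (is "finite ?R")
proof (rule inj_on_finite)
  define B where "B = \<lceil>(\<bar>s\<bar> + 1) * \<bar>N\<bar>\<rceil>"
  show "inj_on quotient_of ?R" by (rule inj_onI) (metis quotient_of_inject)
  show "quotient_of ` ?R \<subseteq> {- B..B} \<times> {0..\<lceil>\<bar>N\<bar>\<rceil>}"
  proof safe
    fix r n d assume r: "\<bar>s - of_rat r\<bar> \<le> 1" "real_of_int (denom r) \<le> N" "(n, d) = quotient_of r"
    obtain m where m: "of_rat r = real_of_int m / denom r" "quotient_of r = (m, denom r)"
      by (rule of_rat_denom)
    have nd: "n = m" "d = denom r" using r(3) m(2) by auto
    have d: "denom r > 0" "real_of_int (denom r) \<le> \<bar>N\<bar>" using denom_pos r(2) by auto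
    have "\<bar>of_rat r\<bar> \<le> \<bar>s\<bar> + 1" using r(1) by linarith
    then have "\<bar>of_rat r\<bar> * denom r \<le> (\<bar>s\<bar> + 1) * \<bar>N\<bar>"
      using d by (intro mult_mono) auto
    moreover have "\<bar>of_rat r\<bar> * denom r = \<bar>real_of_int n\<bar>" using m(1) d by (simp add: nd)
    ultimately have "\<bar>real_of_int n\<bar> \<le> B" unfolding B_def by linarith
    then show "n \<in> {- B..B}" "d \<in> {0..\<lceil>\<bar>N\<bar>\<rceil>}"
      using d nd by (auto simp: abs_le_iff le_ceiling_iff)
  qed
qed simp

lemma inverse_powr_denom_le_1: "v \<ge> 0 \<Longrightarrow> 1 / of_int (denom r) powr v \<le> (1::real)"
proof -
  assume "v \<ge> 0"
  moreover have "real_of_int (denom r) \<ge> 1" using denom_pos[of r] by simp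
  ultimately have "real_of_int (denom r) powr v \<ge> 1" by (rule ge_one_powr_ge_zero[rotated])
  then have "1 / real_of_int (denom r) powr v \<le> 1 / 1" by (intro divide_left_mono) auto
  then show ?thesis by (simp only: div_by_1)
qed

lemma infinite_imp_large_denom:
  fixes s N :: real
  assumes "infinite A" "\<And>r. r \<in> A \<Longrightarrow> \<bar>s - of_rat r\<bar> \<le> 1"
  shows "infinite {r \<in> A. real_of_int (denom r) > N}"
proof
  assume "finite {r \<in> A. real_of_int (denom r) > N}"
  moreover have "finite {r \<in> A. real_of_int (denom r) \<le> N}"
    by (rule finite_subset[OF _ finite_denom_le[of s N]]) (use assms(2) in auto)
  ultimately have "finite ({r \<in> A. real_of_int (denom r) > N} \<union> {r \<in> A. real_of_int (denom r) \<le> N})"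
    by simp
  moreover have "{r \<in> A. real_of_int (denom r) > N} \<union> {r \<in> A. real_of_int (denom r) \<le> N} = A" by auto
  ultimately show False using assms(1) by simp
qed

definition odd_approx :: "real \<Rightarrow> real \<Rightarrow> rat set" where
  "odd_approx s v = {r. 0 < s - of_rat r \<and> s - of_rat r < 1 / of_int (denom r) powr v}"

lemma dioph_exp_odd_alt: "dioph_exp_odd s = Sup {ereal v | v. infinite (odd_approx s v)}"
  by (simp add: dioph_exp_odd_def odd_approx_def)

text \<open>Negation preserves denominators and exchanges the two sides, so facts on the even
  exponent follow from those on the odd one.\<close>

lemma even_approx_eq:
  "{r. 0 < of_rat r - s \<and> of_rat r - s < 1 / of_int (denom r) powr v} = uminus ` odd_approx (- s) v"
proof -
  have "r \<in> uminus ` A \<longleftrightarrow> - r \<in> A" for r :: rat and A by force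
  then show ?thesis by (auto simp: odd_approx_def denom_uminus of_rat_minus)
qed

lemma dioph_exp_even_eq: "dioph_exp_even s = dioph_exp_odd (- s)"
  unfolding dioph_exp_odd_alt dioph_exp_even_def even_approx_eq by (simp add: finite_image_iff)

lemma odd_approx_mono: "v' \<le> v \<Longrightarrow> odd_approx s v \<subseteq> odd_approx s v'"
proof -
  assume v: "v' \<le> v"
  have "1 / of_int (denom r) powr v \<le> 1 / of_int (denom r) powr v'" for r
  proof -
    have "real_of_int (denom r) \<ge> 1" using denom_pos[of r] by simp
    then show ?thesis using v by (intro divide_left_mono powr_mono) auto
  qed
  then show ?thesis unfolding odd_approx_def by (auto intro: order_less_le_trans)
qed

lemma odd_approx_dist: "r \<in> odd_approx s v \<Longrightarrow> v \<ge> 0 \<Longrightarrow> \<bar>s - of_rat r\<bar> \<le> 1"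
  using inverse_powr_denom_le_1[of v r] by (auto simp: odd_approx_def)

lemma infinite_odd_approx:
  assumes "ereal v < dioph_exp_odd s"
  shows "infinite (odd_approx s v)"
proof -
  obtain v' where "v < v'" "infinite (odd_approx s v')"
    using assms by (auto simp: dioph_exp_odd_alt less_Sup_iff)
  then show ?thesis using odd_approx_mono[of v v' s] infinite_super by auto
qed

text \<open>Above the exponent only finitely many fractions approximate well, and \<open>c\<close>
  accounts for them. The pair \<open>P\<close>, \<open>Q\<close> may have common factors, since
  reducing it only strengthens the bound.\<close>

lemma odd_approx_lower_bound:
  assumes "dioph_exp_odd s < ereal v" "v \<ge> 0"
  obtains c where "c > 0"
    "\<And>(P :: int) (Q :: int). Q \<ge> 1 \<Longrightarrow> s - of_int P / of_int Q > 0 \<Longrightarrow> s - of_int P / of_int Q \<ge> c * of_int Q powr (- v)"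
proof -
  have fin: "finite (odd_approx s v)"
  proof (rule ccontr)
    assume "infinite (odd_approx s v)"
    then have "ereal v \<le> dioph_exp_odd s" unfolding dioph_exp_odd_alt by (auto intro: Sup_upper)
    then show False using assms by simp
  qed
  \<comment> \<open>The element 1 makes \<open>M\<close> nonempty and covers all fractions outside
    \<open>odd_approx s v\<close>.\<close>
  define M where "M = insert 1 ((\<lambda>r. (s - of_rat r) * of_int (denom r) powr v) ` odd_approx s v)"
  have M: "finite M" "M \<noteq> {}" "\<And>x. x \<in> M \<Longrightarrow> x > 0"
    using fin by (auto simp: M_def odd_approx_def less_imp_neq[OF denom_pos, symmetric])
  define c where "c = Min M"
  have c: "c > 0" "c \<le> 1" using M by (auto simp: c_def M_def)
  have "s - of_int P / of_int Q \<ge> c * of_int Q powr (- v)"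
    if Q: "Q \<ge> 1" "s - of_int P / of_int Q > 0" for P Q :: int
  proof -
    define r where "r = Fract P Q"
    have r: "of_rat r = real_of_int P / of_int Q" using Q by (simp add: r_def of_rat_Fract)
    have d: "real_of_int (denom r) \<ge> 1" "denom r \<le> Q"
      using denom_pos[of r] denom_le[OF _ r] Q by auto
    have "real_of_int Q powr (- v) \<le> of_int (denom r) powr (- v)"
      using d assms(2) by (intro powr_mono2') auto
    then have "c * of_int Q powr (- v) \<le> c * of_int (denom r) powr (- v)"
      using c by (intro mult_left_mono) auto
    also have "\<dots> \<le> s - of_rat r"
    proof (cases "r \<in> odd_approx s v")
      case True
      then have "c \<le> (s - of_rat r) * of_int (denom r) powr v"
        using M unfolding c_def by (intro Min_le) (auto simp: M_def)
      then have "c * of_int (denom r) powr (- v)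
          \<le> ((s - of_rat r) * of_int (denom r) powr v) * of_int (denom r) powr (- v)"
        by (intro mult_right_mono) auto
      also have "\<dots> = s - of_rat r" using d by (simp add: powr_minus)
      finally show ?thesis .
    next
      case False
      then have "1 * of_int (denom r) powr (- v) \<le> s - of_rat r"
        using Q by (simp add: odd_approx_def r powr_minus divide_inverse)
      moreover have "c * of_int (denom r) powr (- v) \<le> 1 * of_int (denom r) powr (- v)"
        using c by (intro mult_right_mono) auto
      ultimately show ?thesis by linarith
    qed
    finally show ?thesis by (simp add: r)
  qed
  then show ?thesis using that c by blast
qed

text \<open>From a good lower fraction \<open>P / Q\<close> one passes to the best adjacent upper fraction and from
  there to the best lower fraction adjacent to it, which is again good.\<close>

lemma next_lower_approximation:
  fixes s :: real and P Q :: int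
  assumes s: "s \<notin> \<rat>" and Q: "coprime P Q" "Q \<ge> 1" "s * Q - P > 0" "Q * (s * Q - P) < 1"
  shows "\<exists>P' Q'. coprime P' Q' \<and> Q' \<ge> 1 \<and> s * Q' - P' > 0 \<and> Q' * (s * Q' - P') < 1 \<and>
    s * Q' - P' < s * Q - P"
proof -
  define l where "l = s * Q - P"
  have l: "l > 0" "Q * l < 1" using Q by (auto simp: l_def)
  obtain Z0 W where bez: "Z0 * Q + W * P = 1" using bezout_int[of Q P] Q(1) by (auto simp: gcd.commute)
  define Y0 where "Y0 = - W"
  \<comment> \<open>Shifts the Bezout pair along \<open>(P, Q)\<close> until the distance
    \<open>\<delta>\<close> of the upper neighbour falls into \<open>[0, l)\<close>.\<close>
  define m where "m = - \<lceil>(s * Y0 - Z0) / l\<rceil>"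
  define Y Z where "Y = Y0 + m * Q" and "Z = Z0 + m * P"
  have det: "Q * Z - P * Y = 1" using bez by (simp add: Y_def Z_def Y0_def algebra_simps)
  define \<delta> where "\<delta> = Z - s * Y"
  define e where "e = - ((s * Y0 - Z0) / l + m)"
  have e: "0 \<le> e" "e < 1" unfolding e_def m_def by linarith+
  have "\<delta> = l * e"
    using l by (simp add: \<delta>_def Y_def Z_def l_def e_def field_simps)
  moreover have "0 \<le> l * e" "l * e < l * 1"
    using e l by (intro mult_nonneg_nonneg mult_strict_left_mono; simp)+
  ultimately have \<delta>: "0 \<le> \<delta>" "\<delta> < l" by simp_all
  have "\<delta> \<noteq> 0"
  proof
    assume "\<delta> = 0"
    then have "s * Y = Z" by (simp add: \<delta>_def)
    moreover from this have "Y \<noteq> 0" using det by auto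
    ultimately have "s = of_int Z / of_int Y" by (simp add: field_simps)
    then show False using s by (auto intro: Rats_divide Rats_of_int)
  qed
  then have \<delta>0: "\<delta> > 0" using \<delta> by simp
  have id: "Y * l + Q * \<delta> = 1"
  proof -
    have "Y * l + Q * \<delta> = of_int (Q * Z - P * Y)" by (simp add: l_def \<delta>_def algebra_simps)
    then show ?thesis by (simp add: det)
  qed
  have "Q * \<delta> < Q * l" using \<delta> Q(2) by simp
  then have "Y * l > 0" using id l by linarith
  then have Y: "Y \<ge> 1" using l by (simp add: zero_less_mult_iff)
  \<comment> \<open>The largest \<open>k\<close> with \<open>k * \<delta> < l\<close>; the new lower
    value lies in \<open>(0, \<delta>]\<close>.\<close>
  define k where "k = \<lceil>l / \<delta>\<rceil> - 1"
  have "l / \<delta> > 1" using \<delta> \<delta>0 by simp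
  then have k: "k \<ge> 1" "k < l / \<delta>" "l / \<delta> \<le> k + 1" unfolding k_def by linarith+
  define P' Q' where "P' = P + k * Z" and "Q' = Q + k * Y"
  have l': "s * Q' - P' = l - k * \<delta>" by (simp add: P'_def Q'_def l_def \<delta>_def algebra_simps)
  have L: "0 < s * Q' - P'" "s * Q' - P' \<le> \<delta>"
    using k \<delta>0 by (simp_all add: l' field_simps)
  have Q': "Q' \<ge> 1" using Q(2) k Y by (simp add: Q'_def add_increasing2)
  have det': "Q' * Z - P' * Y = 1" using det by (simp add: Q'_def P'_def algebra_simps)
  have "coprime P' Q'"
  proof (rule coprimeI)
    fix c assume "c dvd P'" "c dvd Q'"
    then have "c dvd Q' * Z - P' * Y" by simp
    then show "is_unit c" by (simp add: det')
  qed
  moreover have "Q' * (s * Q' - P') < 1"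
  proof -
    have "Y * (s * Q' - P') + Q' * \<delta> = of_int (Q' * Z - P' * Y)" by (simp add: \<delta>_def algebra_simps)
    then have "Y * (s * Q' - P') + Q' * \<delta> = 1" by (simp add: det')
    moreover have "Y * (s * Q' - P') > 0" using Y L by simp
    moreover have "Q' * (s * Q' - P') \<le> Q' * \<delta>" using L Q' by (intro mult_left_mono) auto
    ultimately show ?thesis by linarith
  qed
  ultimately show ?thesis using L Q' \<delta> unfolding l_def by (intro exI[of _ P'] exI[of _ Q']) auto
qed

text \<open>The fractions with \<open>Q * (s * Q - P) < 1\<close> include the floor of
  \<open>s\<close>, and by \<open>next_lower_approximation\<close> none of them minimizes
  \<open>s * Q - P\<close>, so there are infinitely many.\<close>

lemma dioph_exp_odd_ge_2:
  assumes s: "s \<notin> \<rat>"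
  shows "dioph_exp_odd s \<ge> 2"
proof -
  define W :: "(int \<times> int) set" where
    "W = {(P, Q). coprime P Q \<and> Q \<ge> 1 \<and> s * Q - P > 0 \<and> Q * (s * Q - P) < 1}"
  define L :: "int \<times> int \<Rightarrow> real" where "L = (\<lambda>(P, Q). s * Q - P)"
  have "infinite W"
  proof
    assume fin: "finite W"
    have "s \<noteq> \<lfloor>s\<rfloor>" using s by (metis Rats_of_int)
    then have "\<lfloor>s\<rfloor> < s" "s - \<lfloor>s\<rfloor> < 1" by linarith+
    then have "(\<lfloor>s\<rfloor>, 1) \<in> W" by (simp add: W_def)
    then have "W \<noteq> {}" by auto
    then obtain w where w: "w \<in> W" "\<And>w'. w' \<in> W \<Longrightarrow> L w \<le> L w'"
      using ex_is_arg_min_if_finite[OF fin, of L] by (auto simp: is_arg_min_linorder)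
    obtain P Q where "w = (P, Q)" by fastforce
    then show False
      using next_lower_approximation[OF s, of P Q] w by (fastforce simp: W_def L_def)
  qed
  moreover have "inj_on (\<lambda>(P, Q). Fract P Q) W"
  proof (rule inj_on_inverseI[of _ quotient_of])
    fix w assume "w \<in> W"
    then show "quotient_of (case w of (P, Q) \<Rightarrow> Fract P Q) = w"
      using quotient_of_Fract by (cases w) (auto simp: W_def)
  qed
  ultimately have "infinite ((\<lambda>(P, Q). Fract P Q) ` W)" by (simp add: finite_image_iff)
  moreover have "(\<lambda>(P, Q). Fract P Q) ` W \<subseteq> odd_approx s 2"
    by (auto simp: W_def odd_approx_def denom_Fract of_rat_Fract field_simps power2_eq_square)
  ultimately have "infinite (odd_approx s 2)" using infinite_super by blast
  then have "ereal 2 \<le> dioph_exp_odd s" unfolding dioph_exp_odd_alt by (auto intro!: Sup_upper)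
  then show ?thesis by simp
qed

lemma dioph_exp_even_ge_2: "s \<notin> \<rat> \<Longrightarrow> dioph_exp_even s \<ge> 2"
  unfolding dioph_exp_even_eq by (rule dioph_exp_odd_ge_2) simp

text \<open>Inversion changes errors and denominators by bounded factors only, collected in
  \<open>c\<close>; the gap between \<open>v'\<close> and \<open>v\<close> absorbs them for large
  denominators.\<close>

lemma inverse_approximations:
  fixes s v v' :: real
  assumes s: "s > 0" and v: "1 \<le> v'" "v' < v" and A: "infinite A"
    and app: "\<And>r. r \<in> A \<Longrightarrow> \<bar>s - of_rat r\<bar> < 1 / of_int (denom r) powr v"
  shows "infinite {r \<in> A. r > 0 \<and> \<bar>1 / s - of_rat (inverse r)\<bar> < 1 / of_int (denom (inverse r)) powr v'}"
proof -
  define c where "c = 2 * (s + 1) powr v' / s\<^sup>2"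
  have "\<forall>\<^sub>F x in at_top. c \<le> x powr (v - v')" using v by real_asymp
  then obtain x0 where x0: "\<And>x. x \<ge> x0 \<Longrightarrow> c \<le> x powr (v - v')"
    by (auto simp: eventually_at_top_linorder)
  have dist: "\<bar>s - of_rat r\<bar> \<le> 1" if "r \<in> A" for r
    using app[OF that] inverse_powr_denom_le_1[of v r] v by simp
  have "infinite {r \<in> A. real_of_int (denom r) > max x0 (2 / s)}"
    using A dist by (rule infinite_imp_large_denom)
  moreover have "{r \<in> A. real_of_int (denom r) > max x0 (2 / s)} \<subseteq>
    {r \<in> A. r > 0 \<and> \<bar>1 / s - of_rat (inverse r)\<bar> < 1 / of_int (denom (inverse r)) powr v'}"
  proof safe
    fix r assume r: "r \<in> A" "real_of_int (denom r) > max x0 (2 / s)"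
    define d where "d = real_of_int (denom r)"
    have d: "d \<ge> 1" "d > x0" "d > 2 / s" using r denom_pos[of r] by (auto simp: d_def)
    define z :: real where "z = of_rat r"
    have z: "\<bar>s - z\<bar> < 1 / d powr v" "z \<le> s + 1" using app[OF r(1)] dist[OF r(1)] by (auto simp: z_def d_def)
    have "d powr 1 \<le> d powr v" using d v by (intro powr_mono) auto
    then have "1 / d powr v \<le> 1 / d" using d by (simp add: frac_le)
    also have "\<dots> < s / 2" using d s by (simp add: field_simps)
    finally have z2: "z > s / 2" using z by linarith
    then show "r > 0" using s by (simp add: z_def zero_less_of_rat_iff[symmetric, where 'a = real] del: zero_less_of_rat_iff)
    then have di: "real_of_int (denom (inverse r)) = z * d" by (simp add: denom_inverse z_def d_def)
    have z0: "z > 0" using z2 s by simp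
    have "\<bar>1 / s - 1 / z\<bar> = \<bar>s - z\<bar> / (s * z)"
      using s z0 by (simp add: field_simps abs_if)
    also have "\<dots> < (1 / d powr v) / (s * z)"
      using z s z0 by (intro divide_strict_right_mono) auto
    also have "\<dots> \<le> (1 / d powr v) / (s * (s / 2))"
      using z2 s z0 d by (intro divide_left_mono mult_left_mono) auto
    also have "\<dots> = (2 / s\<^sup>2) * d powr (- v)" using s by (simp add: powr_minus field_simps power2_eq_square)
    also have "\<dots> \<le> 1 / ((s + 1) * d) powr v'"
    proof -
      have "2 / s\<^sup>2 * (s + 1) powr v' \<le> d powr (v - v')" using x0[of d] d by (simp add: c_def)
      then have "2 / s\<^sup>2 * (s + 1) powr v' * (d powr (- v) * d powr v') \<le>
          d powr (v - v') * (d powr (- v) * d powr v')"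
        by (intro mult_right_mono) auto
      also have "\<dots> = 1" using d by (simp flip: powr_add)
      finally have "2 / s\<^sup>2 * d powr (- v) * ((s + 1) * d) powr v' \<le> 1"
        by (simp add: powr_mult mult_ac)
      moreover have "((s + 1) * d) powr v' > 0" using s d by simp
      ultimately show ?thesis by (simp only: pos_le_divide_eq)
    qed
    also have "\<dots> \<le> 1 / (z * d) powr v'"
      using z z0 d v s by (intro divide_left_mono powr_mono2 mult_right_mono) auto
    finally show "\<bar>1 / s - of_rat (inverse r)\<bar> < 1 / of_int (denom (inverse r)) powr v'"
      by (simp add: di z_def of_rat_inverse divide_inverse)
  qed
  ultimately show ?thesis using infinite_super by blast
qed

text \<open>An arbitrarily small loss in the exponent does not affect the supremum;
  \<open>1 \<le> v'\<close> is available because \<open>e \<ge> 2\<close>.\<close>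

lemma exponent_le_transfer:
  fixes A B :: "real \<Rightarrow> rat set" and e :: ereal
  assumes e: "e \<ge> 2" "e = Sup {ereal v | v. infinite (B v)}"
    and AB: "\<And>v v'. 1 \<le> v' \<Longrightarrow> v' < v \<Longrightarrow> infinite (A v) \<Longrightarrow> infinite (B v')"
  shows "Sup {ereal v | v. infinite (A v)} \<le> e"
proof (rule Sup_least)
  fix x assume "x \<in> {ereal v | v. infinite (A v)}"
  then obtain v where v: "x = ereal v" "infinite (A v)" by auto
  show "x \<le> e"
  proof (rule ccontr)
    assume "\<not> x \<le> e"
    then obtain v' where v': "e < ereal v'" "ereal v' < ereal v"
      using ereal_dense2[of e "ereal v"] v by (auto simp: not_le)
    have "(1::ereal) < 2" by simp
    also note e(1)
    also note v'(1)
    finally have "1 < v'" by (simp add: one_ereal_def)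
    then have "infinite (B v')" using AB[of v' v] v v' by auto
    then have "ereal v' \<le> e" unfolding e(2) by (auto intro!: Sup_upper)
    then show False using v' by simp
  qed
qed

text \<open>Inversion reverses the order of positive numbers, hence exchanges approximation from
  above and from below.\<close>

lemma dioph_exp_even_inverse:
  assumes s: "s > 0" "s \<notin> \<rat>"
  shows "dioph_exp_even (1 / s) = dioph_exp_odd s"
proof (rule antisym)
  have irr: "1 / s \<notin> \<rat>"
    using s by (metis Rats_1 Rats_divide div_by_1 divide_divide_eq_right mult_1)
  have inj: "inj_on inverse (X :: rat set)" for X by (rule inj_onI) simp
  have less: "inverse (of_rat r :: real) < 1 / s \<longleftrightarrow> s < of_rat r"
    "1 / s < inverse (of_rat r :: real) \<longleftrightarrow> of_rat r < s" if "r > 0" for r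
    using s that by (auto simp: field_simps)
  show "dioph_exp_odd s \<le> dioph_exp_even (1 / s)"
    unfolding dioph_exp_odd_def
  proof (rule exponent_le_transfer[OF dioph_exp_even_ge_2[OF irr] dioph_exp_even_def])
    fix v v' :: real assume v: "1 \<le> v'" "v' < v"
      and inf: "infinite {r. 0 < s - of_rat r \<and> s - of_rat r < 1 / of_int (denom r) powr v}"
    have "infinite (inverse ` {r \<in> {r. 0 < s - of_rat r \<and> s - of_rat r < 1 / of_int (denom r) powr v}.
       r > 0 \<and> \<bar>1 / s - of_rat (inverse r)\<bar> < 1 / of_int (denom (inverse r)) powr v'})"
      unfolding finite_image_iff[OF inj] by (rule inverse_approximations[OF s(1) v inf]) auto
    then show "infinite {r. 0 < of_rat r - 1 / s \<and> of_rat r - 1 / s < 1 / of_int (denom r) powr v'}"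
      by (rule infinite_super[rotated]) (auto simp: of_rat_inverse less)
  qed
  show "dioph_exp_even (1 / s) \<le> dioph_exp_odd s"
    unfolding dioph_exp_even_def
  proof (rule exponent_le_transfer[OF dioph_exp_odd_ge_2[OF s(2)] dioph_exp_odd_def])
    fix v v' :: real assume v: "1 \<le> v'" "v' < v"
      and inf: "infinite {r. 0 < of_rat r - 1 / s \<and> of_rat r - 1 / s < 1 / of_int (denom r) powr v}"
    have "infinite (inverse ` {r \<in> {r. 0 < of_rat r - 1 / s \<and> of_rat r - 1 / s < 1 / of_int (denom r) powr v}.
       r > 0 \<and> \<bar>1 / (1 / s) - of_rat (inverse r)\<bar> < 1 / of_int (denom (inverse r)) powr v'})"
      unfolding finite_image_iff[OF inj]
      by (rule inverse_approximations[OF _ v inf]) (use s in auto)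
    moreover have "inverse (of_rat r :: real) < s" if "0 < of_rat r - 1 / s" "r > 0" for r
      using that s by (auto simp: field_simps)
    ultimately show "infinite {r. 0 < s - of_rat r \<and> s - of_rat r < 1 / of_int (denom r) powr v'}"
      by (elim infinite_super[rotated]) (auto simp: of_rat_inverse)
  qed
qed

section \<open>Growth of the sums\<close>

lemma exp_frac_ereal: "e \<noteq> 0 \<Longrightarrow> exp_frac (ereal c) (ereal e) = ereal ((e - c) / e)"
  by (simp add: exp_frac_def)

lemma exp_frac_infinity: "exp_frac c \<infinity> = 1"
  by (simp add: exp_frac_def)

text \<open>Since \<open>v \<mapsto> (v - c) / v\<close> is increasing, a bound \<open>x < exp_frac c e\<close> is attained
  already at some real \<open>v < e\<close>.\<close>

lemma less_exp_frac:
  assumes "e \<ge> 2" "ereal x < exp_frac (ereal c) e" "c > 0" "ereal m < e"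
  obtains v where "m < v" "0 < v" "ereal v < e" "x < (v - c) / v"
proof -
  have x1: "x < 1"
  proof (cases e)
    case (real r)
    then have "(r - c) / r < 1" "x < (r - c) / r" using assms by (auto simp: field_simps exp_frac_ereal)
    then show ?thesis by linarith
  qed (use assms in \<open>auto simp: exp_frac_infinity one_ereal_def\<close>)
  \<comment> \<open>\<open>c / (1 - x)\<close> is the solution \<open>v\<close> of
    \<open>(v - c) / v = x\<close>.\<close>
  have "ereal (c / (1 - x)) < e"
  proof (cases e)
    case (real r)
    then have "r > 0" "x < (r - c) / r" using assms by (auto simp: exp_frac_ereal)
    then show ?thesis using x1 real by (simp add: field_simps)
  qed (use assms in auto)
  then have "ereal (max (max m 0) (c / (1 - x))) < e"
    using assms by (auto simp: max_def zero_ereal_def[symmetric] intro: less_le_trans[of 0 2 e])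
  then obtain v where v: "ereal (max (max m 0) (c / (1 - x))) < ereal v" "ereal v < e"
    using ereal_dense2 by blast
  then have "v > m" "v > 0" "c / (1 - x) < v" by auto
  then have "x < (v - c) / v" using x1 by (simp add: field_simps)
  then show ?thesis using that v \<open>v > m\<close> \<open>v > 0\<close> by blast
qed

lemma quotient_perturb_le:
  fixes r c \<eta> :: real
  assumes "r \<ge> 2" "0 \<le> c" "c \<le> 2" "\<eta> > 0"
  shows "(r + \<eta> - c) / (r + \<eta>) \<le> (r - c) / r + \<eta>"
proof -
  have "(r + \<eta> - c) / (r + \<eta>) - (r - c) / r = c * \<eta> / (r * (r + \<eta>))"
    using assms by (simp add: field_simps)
  also have "\<dots> \<le> (2 * \<eta>) / (2 * 1)"
    using assms by (intro frac_le mult_mono mult_pos_pos) auto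
  finally show ?thesis by simp
qed

context bcz_orbit
begin

abbreviation "s \<equiv> b / a"

lemma exponents_ge_2: "dioph_exp_odd s \<ge> 2" "dioph_exp_even s \<ge> 2"
  using dioph_exp_odd_ge_2 dioph_exp_even_ge_2 irrational by auto

lemma form_eq: "Q * b - P * a = a * (Q * (s - P / Q))" if "Q \<noteq> 0" for P Q :: real
  using that ab by (simp add: field_simps)

text \<open>If an exponent is infinite then \<open>\<theta> \<ge> 1\<close> and the crude bound
  suffices. Otherwise the Diophantine lower bounds hold slightly above the exponents, and
  \<open>quotient_perturb_le\<close> controls the loss.\<close>

lemma length_word_growth_exponents:
  assumes \<theta>: "ereal \<theta> = max (exp_frac 1 (dioph_exp_odd s)) (exp_frac 2 (dioph_exp_even s))"
    and \<epsilon>: "\<epsilon> > 0"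
  shows "\<forall>\<^sub>F n in sequentially. length (word n) \<le> real n powr (\<theta> + \<epsilon>)"
proof (cases "dioph_exp_odd s = \<infinity> \<or> dioph_exp_even s = \<infinity>")
  case True
  then have "ereal 1 \<le> ereal \<theta>" unfolding \<theta> by (auto simp: exp_frac_infinity le_max_iff_disj one_ereal_def)
  then have "1 + \<epsilon> \<le> \<theta> + \<epsilon>" by simp
  show ?thesis
    using length_word_crude[OF \<epsilon>] eventually_ge_at_top[of "1::nat"]
  proof eventually_elim
    case (elim n)
    have "real n powr (1 + \<epsilon>) \<le> real n powr (\<theta> + \<epsilon>)"
      using \<open>1 + \<epsilon> \<le> \<theta> + \<epsilon>\<close> elim by (intro powr_mono) auto
    then show ?case using elim by linarith
  qed
next
  case False
  then obtain r r' where r: "dioph_exp_odd s = ereal r" "dioph_exp_even s = ereal r'"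
    using exponents_ge_2 by (cases "dioph_exp_odd s"; cases "dioph_exp_even s") auto
  have r2: "r \<ge> 2" "r' \<ge> 2" using exponents_ge_2 r by auto
  define \<eta> where "\<eta> = \<epsilon> / 2"
  have \<eta>: "\<eta> > 0" using \<epsilon> by (simp add: \<eta>_def)
  have "\<theta> = max ((r - 1) / r) ((r' - 2) / r')"
    using \<theta> r2 exp_frac_ereal[of r 1] exp_frac_ereal[of r' 2]
    by (simp add: r one_ereal_def[symmetric] max_def split: if_splits)
  then have th: "(r - 1) / r \<le> \<theta>" "(r' - 2) / r' \<le> \<theta>" by auto
  \<comment> \<open>The minimum with 1 meets the hypothesis \<open>\<theta> \<le> 1\<close> of
    \<open>length_word_growth\<close>.\<close>
  define v v' \<theta>' where "v = r + \<eta>" and "v' = r' + \<eta>" and "\<theta>' = min 1 (\<theta> + \<eta>)"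
  have v: "v \<ge> 2" "v' \<ge> 2" "dioph_exp_odd s < ereal v" "dioph_exp_even s < ereal v'"
    using r r2 \<eta> by (auto simp: v_def v'_def)
  have \<theta>': "(v - 1) / v \<le> \<theta>'" "(v' - 2) / v' \<le> \<theta>'" "\<theta>' \<le> 1"
    using quotient_perturb_le[of r 1 \<eta>] quotient_perturb_le[of r' 2 \<eta>] r2 \<eta> th v
    by (auto simp: v_def v'_def \<theta>'_def)
  have v0: "v \<ge> 0" "v' \<ge> 0" using v by auto
  obtain c where c: "c > 0"
    "\<And>(P :: int) (Q :: int). Q \<ge> 1 \<Longrightarrow> s - of_int P / of_int Q > 0 \<Longrightarrow> s - of_int P / of_int Q \<ge> c * of_int Q powr (- v)"
    using odd_approx_lower_bound[OF v(3) v0(1)] by blast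
  obtain c' where c': "c' > 0"
    "\<And>(P :: int) (Q :: int). Q \<ge> 1 \<Longrightarrow> - s - of_int P / of_int Q > 0 \<Longrightarrow> - s - of_int P / of_int Q \<ge> c' * of_int Q powr (- v')"
    using odd_approx_lower_bound[of "- s", OF v(4)[unfolded dioph_exp_even_eq] v0(2)] by blast
  define d where "d = a * min c c'"
  have d: "d > 0" "d \<le> a * c" "d \<le> a * c'" using ab c(1) c'(1) by (auto simp: d_def)
  have scale: "d * Q powr (1 - w) \<le> a * (Q * z)"
    if "Q \<ge> 1" "d \<le> a * k" "k * Q powr (- w) \<le> z" for Q w z k :: real
  proof -
    have "d * Q powr (1 - w) \<le> (a * k) * Q powr (1 - w)" using that by (intro mult_right_mono) auto
    also have "\<dots> = a * (Q * (k * Q powr (- w)))"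
      using that by (simp add: powr_diff powr_minus field_simps)
    also have "\<dots> \<le> a * (Q * z)" using that ab by (intro mult_left_mono) auto
    finally show ?thesis .
  qed
  have odd: "Q * b - P * a \<ge> d * Q powr (1 - v)" if "Q \<ge> 1" "Q * b - P * a > 0" for P Q :: int
  proof -
    have eq: "Q * b - P * a = a * (Q * (s - P / Q))" using form_eq that by simp
    then have "s - P / Q > 0" using that ab by (simp add: zero_less_mult_iff)
    then show ?thesis unfolding eq using scale[OF _ d(2) c(2)] that by simp
  qed
  have even: "P * a - Q * b \<ge> d * Q powr (1 - v')" if "Q \<ge> 1" "Q * b - P * a < 0" for P Q :: int
  proof -
    have "Q * b - P * a = a * (Q * (s - P / Q))" using form_eq that by simp
    then have eq: "P * a - Q * b = a * (Q * (- s - of_int (- P) / Q))" by (simp add: algebra_simps)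
    have "a * (Q * (- s - of_int (- P) / Q)) > 0" using eq that by linarith
    then have "Q * (- s - of_int (- P) / Q) > 0" using ab(1) by (rule zero_less_mult_pos)
    then have "- s - of_int (- P) / Q > 0" by (rule zero_less_mult_pos) (use that in simp)
    then show ?thesis
      unfolding eq by (intro scale[OF _ d(3)] c'(2)) (use that in auto)
  qed
  have "\<forall>\<^sub>F n in sequentially. length (word n) \<le> real n powr (\<theta>' + \<eta>)"
    by (rule length_word_growth[OF _ _ d(1) v(1,2) \<theta>' \<eta>]) (erule (1) odd, erule (1) even)
  then show ?thesis
    using eventually_ge_at_top[of "1::nat"]
  proof eventually_elim
    case (elim n)
    have "real n powr (\<theta>' + \<eta>) \<le> real n powr (\<theta> + \<epsilon>)"
      using elim by (intro powr_mono) (auto simp: \<theta>'_def \<eta>_def)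
    then show ?case using elim by linarith
  qed
qed

text \<open>The larger of the two fractions decides whether lower or upper approximations of
  \<open>b / a\<close> produce the large sums.\<close>

lemma f_hat_lower:
  assumes \<theta>: "ereal \<theta> = max (exp_frac 1 (dioph_exp_odd s)) (exp_frac 2 (dioph_exp_even s))"
    and \<theta>2: "\<theta> \<ge> 1 / 2" and \<epsilon>: "\<epsilon> > 0"
  shows "\<exists>\<^sub>F n in sequentially. real n powr (\<theta> - \<epsilon>) \<le> \<bar>f_hat (a, b) n\<bar>"
proof -
  have reduce: ?thesis
    if H: "\<And>\<rho>. 0 < \<rho> \<Longrightarrow> \<rho> < w \<Longrightarrow> \<exists>\<^sub>F n in sequentially. real n powr \<rho> \<le> \<bar>f_hat (a, b) n\<bar>"
      "\<theta> - \<epsilon> < w" "0 < w" for w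
  proof -
    obtain \<rho> where \<rho>: "max 0 (\<theta> - \<epsilon>) < \<rho>" "\<rho> < w" using dense[of "max 0 (\<theta> - \<epsilon>)" w] H(2,3) by (metis max_less_iff_conj)
    have "\<exists>\<^sub>F n in sequentially. n \<ge> 1 \<and> real n powr \<rho> \<le> \<bar>f_hat (a, b) n\<bar>"
      by (rule frequently_eventually_conj[OF H(1)]) (use \<rho> eventually_ge_at_top in auto)
    then show ?thesis
    proof (rule frequently_elim1, elim conjE)
      fix n :: nat assume n: "n \<ge> 1" "real n powr \<rho> \<le> \<bar>f_hat (a, b) n\<bar>"
      have "real n powr (\<theta> - \<epsilon>) \<le> real n powr \<rho>" using n \<rho> by (intro powr_mono) auto
      then show "real n powr (\<theta> - \<epsilon>) \<le> \<bar>f_hat (a, b) n\<bar>" using n by linarith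
    qed
  qed
  have s0: "s > 0" using ab by simp
  show ?thesis
  proof (cases "exp_frac 2 (dioph_exp_even s) \<le> exp_frac 1 (dioph_exp_odd s)")
    case True
    then have \<theta>o: "exp_frac 1 (dioph_exp_odd s) = ereal \<theta>" using \<theta> by (simp add: max_def)
    have "ereal (\<theta> - \<epsilon>) < exp_frac (ereal 1) (dioph_exp_odd s)"
      unfolding one_ereal_def[symmetric] \<theta>o using \<epsilon> by simp
    moreover have "ereal 1 < dioph_exp_odd s" using exponents_ge_2(1) by (rule less_le_trans[rotated]) simp
    ultimately obtain v where v: "1 < v" "ereal v < dioph_exp_odd s" "\<theta> - \<epsilon> < (v - 1) / v"
      using less_exp_frac[of "dioph_exp_odd s" "\<theta> - \<epsilon>" 1 1] exponents_ge_2(1) by auto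
    have inf: "infinite (odd_approx s v)" using v(2) by (rule infinite_odd_approx)
    have "\<exists>P Q :: int. real_of_int Q \<ge> N \<and> Q \<ge> 1 \<and> P \<ge> 0 \<and> coprime P Q \<and>
      Q * b - P * a > 0 \<and> Q * b - P * a \<le> Q powr (1 - v)" for N
    proof -
      \<comment> \<open>Denominators beyond \<open>1 / s\<close> ensure that the approximating
        fractions are positive.\<close>
      have "infinite {r \<in> odd_approx s v. real_of_int (denom r) > max N (1 / s)}"
        using inf by (rule infinite_imp_large_denom[where s = s]) (use odd_approx_dist v in auto)
      then obtain r where r: "r \<in> odd_approx s v" "real_of_int (denom r) > max N (1 / s)"
        using not_finite_existsD by blast
      obtain P where P: "of_rat r = real_of_int P / denom r" "coprime P (denom r)" by (rule of_rat_denom)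
      define Q where "Q = denom r"
      have Q: "Q \<ge> 1" "real_of_int Q > N" "1 / s < Q" using denom_pos[of r] r by (auto simp: Q_def)
      have PQ: "s - P / Q > 0" "s - P / Q < 1 / Q powr v"
        using r(1) P(1) by (auto simp: odd_approx_def Q_def)
      have "real_of_int Q powr 1 \<le> Q powr v" using Q v by (intro powr_mono) auto
      then have "1 / Q powr v \<le> 1 / real_of_int Q" using Q by (simp add: frac_le)
      also have "\<dots> < s" using Q s0 ab by (simp add: field_simps)
      finally have "real_of_int P / Q > 0" using PQ by linarith
      then have "P \<ge> 0" using Q by (simp add: zero_less_divide_iff)
      have eq: "Q * b - P * a = a * (Q * (s - P / Q))" using form_eq Q by simp
      have "a * (Q * (s - P / Q)) \<le> 1 * (Q * (1 / Q powr v))"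
        using PQ Q ab by (intro mult_mono mult_left_mono) auto
      also have "\<dots> = Q powr (1 - v)" using Q by (simp add: powr_diff)
      finally show ?thesis
        using Q P(2) \<open>P \<ge> 0\<close> PQ ab eq unfolding Q_def[symmetric]
        by (intro exI[of _ P] exI[of _ Q]) auto
    qed
    then have "\<exists>\<^sub>F n in sequentially. real n powr \<rho> \<le> \<bar>f_hat (a, b) n\<bar>"
      if "0 < \<rho>" "\<rho> < (v - 1) / v" for \<rho> using f_hat_frequently_odd[OF v(1) that] by blast
    then show ?thesis by (rule reduce) (use v in auto)
  next
    case False
    then have \<theta>e: "exp_frac 2 (dioph_exp_even s) = ereal \<theta>"
      using \<theta> by (simp add: max.absorb2 not_le less_imp_le)
    \<comment> \<open>The odd fraction is always at least \<open>1 / 2\<close>; the even one exceeds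
      it here, which means \<open>e\<^sup>+ > 4\<close>.\<close>
    have gt: "exp_frac 2 (dioph_exp_even s) > ereal (1 / 2)"
    proof -
      have "exp_frac 1 (dioph_exp_odd s) \<ge> ereal (1 / 2)"
      proof (cases "dioph_exp_odd s")
        case (real r)
        then have "r \<ge> 2" using exponents_ge_2(1) by simp
        then show ?thesis using exp_frac_ereal[of r 1] real by (simp add: one_ereal_def field_simps)
      next
        case PInf
        have "ereal (1 / 2) \<le> ereal 1" by simp
        then show ?thesis unfolding PInf exp_frac_infinity one_ereal_def .
      qed (use exponents_ge_2(1) in auto)
      then show ?thesis using False by auto
    qed
    have "ereal (\<theta> - \<epsilon>) < exp_frac (ereal 2) (dioph_exp_even s)" using \<theta>e \<epsilon> by simp
    moreover have "ereal 4 < dioph_exp_even s"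
    proof (cases "dioph_exp_even s")
      case (real r)
      then have "r \<ge> 2" using exponents_ge_2(2) by simp
      then show ?thesis using gt exp_frac_ereal[of r 2] real by (simp add: field_simps)
    qed (use exponents_ge_2(2) in auto)
    ultimately obtain v where v: "4 < v" "ereal v < dioph_exp_even s" "\<theta> - \<epsilon> < (v - 2) / v"
      using less_exp_frac[of "dioph_exp_even s" "\<theta> - \<epsilon>" 2 4] exponents_ge_2(2) by auto
    have inf: "infinite (odd_approx (- s) v)"
      using v(2) unfolding dioph_exp_even_eq by (rule infinite_odd_approx)
    have "\<exists>P Q :: int. real_of_int Q \<ge> N \<and> Q \<ge> 1 \<and> coprime P Q \<and>
      P * a - Q * b > 0 \<and> P * a - Q * b \<le> a * Q powr (1 - v)" for N
    proof -
      have "infinite {r \<in> odd_approx (- s) v. real_of_int (denom r) > N}"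
        using inf by (rule infinite_imp_large_denom[where s = "- s"]) (use odd_approx_dist v in auto)
      then obtain r where r: "r \<in> odd_approx (- s) v" "real_of_int (denom r) > N"
        using not_finite_existsD by blast
      obtain P where P: "of_rat r = real_of_int P / denom r" "coprime P (denom r)" by (rule of_rat_denom)
      define Q where "Q = denom r"
      have Q: "Q \<ge> 1" "real_of_int Q > N" using denom_pos[of r] r by (auto simp: Q_def)
      have PQ: "- s - P / Q > 0" "- s - P / Q < 1 / Q powr v"
        using r(1) P(1) by (auto simp: odd_approx_def Q_def)
      have "Q * b - (- P) * a = a * (Q * (s - (- P) / Q))"
        using form_eq[of Q "- real_of_int P"] Q by simp
      then have eq: "(- P) * a - Q * b = a * (Q * (- s - P / Q))" by (simp add: algebra_simps)
      have "a * (Q * (- s - P / Q)) \<le> a * (Q * (1 / Q powr v))"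
        using PQ Q ab by (intro mult_left_mono) auto
      also have "\<dots> = a * Q powr (1 - v)" using Q by (simp add: powr_diff)
      finally show ?thesis
        using Q P(2) PQ ab eq unfolding Q_def[symmetric]
        by (intro exI[of _ "- P"] exI[of _ Q]) auto
    qed
    then have "\<exists>\<^sub>F n in sequentially. real n powr \<rho> \<le> \<bar>f_hat (a, b) n\<bar>"
      if "0 < \<rho>" "\<rho> < (v - 2) / v" for \<rho> using f_hat_frequently_even[OF v(1) that] by blast
    then show ?thesis by (rule reduce) (use v in auto)
  qed
qed

lemma f_hat_grows:
  obtains \<theta> where "ereal \<theta> = max (exp_frac 1 (dioph_exp_odd s)) (exp_frac 2 (dioph_exp_even s))"
    "\<theta> \<ge> 1 / 2" "grows (f_hat (a, b)) \<theta>"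
proof -
  have real: "\<exists>x. exp_frac (ereal c) e = ereal x" if "e \<ge> 2" for c e
    using that by (cases e) (auto simp: exp_frac_ereal exp_frac_infinity one_ereal_def)
  obtain x z where xz: "exp_frac 1 (dioph_exp_odd s) = ereal x" "exp_frac 2 (dioph_exp_even s) = ereal z"
    using real[of "dioph_exp_odd s" 1] real[of "dioph_exp_even s" 2] exponents_ge_2
    by (auto simp: one_ereal_def[symmetric])
  have x: "x \<ge> 1 / 2"
  proof (cases "dioph_exp_odd s")
    case (real r)
    then have "r \<ge> 2" using exponents_ge_2(1) by simp
    then have "(r - 1) / r \<ge> 1 / 2" "x = (r - 1) / r"
      using exp_frac_ereal[of r 1] real xz(1) by (simp_all add: one_ereal_def field_simps)
    then show ?thesis by simp
  qed (use xz(1) exponents_ge_2(1) in \<open>auto simp: exp_frac_infinity one_ereal_def\<close>)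
  define \<theta> where "\<theta> = max x z"
  have \<theta>: "ereal \<theta> = max (exp_frac 1 (dioph_exp_odd s)) (exp_frac 2 (dioph_exp_even s))" "\<theta> \<ge> 1 / 2"
    unfolding xz \<theta>_def using x by (simp_all add: max_def)
  have "grows (f_hat (a, b)) \<theta>"
    unfolding grows_def
    using f_hat_upper[OF length_word_growth_exponents[OF \<theta>(1)]] f_hat_lower[OF \<theta>] \<theta>(2) by auto
  then show ?thesis using that \<theta> by blast
qed

end

section \<open>Time reversal\<close>

lemma farey_triangle_swap: "prod.swap p \<in> farey_triangle \<longleftrightarrow> p \<in> farey_triangle"
  by (cases p) (auto simp: farey_triangle_def)

text \<open>The map is reversible: exchanging the coordinates conjugates it to its inverse.\<close>

lemma bcz_inv_swap:
  assumes "p \<in> farey_triangle"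
  shows "bcz_inv p = prod.swap (bcz (prod.swap p))"
proof -
  obtain x z where p: "p = (x, z)" by fastforce
  have zx: "(z, x) \<in> farey_triangle" using assms farey_triangle_swap[of p] by (simp add: p)
  obtain w where w: "bcz (z, x) = (x, w)" by (simp add: bcz_def)
  have "z = - w + of_int \<lfloor>(1 + w) / x\<rfloor> * x" by (rule bcz_left_inverse(2)[OF zx w])
  then have "bcz (w, x) = p" by (simp add: bcz_def p)
  moreover have "(w, x) \<in> farey_triangle"
    using bcz_left_inverse(1)[OF zx w] farey_triangle_swap[of "(x, w)"] by simp
  ultimately have "bcz_inv p = (w, x)"
    unfolding bcz_inv_def by (intro inv_into_f_eq bij_betw_imp_inj_on[OF bcz_bij])
  then show ?thesis by (simp add: p w)
qed

lemma bcz_inv_funpow: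
  assumes "p \<in> farey_triangle"
  shows "(bcz_inv ^^ n) p = prod.swap ((bcz ^^ n) (prod.swap p))"
    and "(bcz ^^ n) (prod.swap p) \<in> farey_triangle"
proof -
  have in_tri: "(bcz ^^ n) (prod.swap p) \<in> farey_triangle" for n
    by (induction n) (use assms farey_triangle_swap farey_triangle_bcz in auto)
  then show "(bcz ^^ n) (prod.swap p) \<in> farey_triangle" .
  show "(bcz_inv ^^ n) p = prod.swap ((bcz ^^ n) (prod.swap p))"
  proof (induction n)
    case (Suc n)
    have "prod.swap ((bcz ^^ n) (prod.swap p)) \<in> farey_triangle"
      using in_tri farey_triangle_swap by blast
    then show ?case using Suc by (simp add: bcz_inv_swap)
  qed simp
qed

lemma itinerary_hat_swap:
  assumes "p \<in> farey_triangle"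
  shows "itinerary_hat (prod.swap p) = itinerary_hat p"
proof (cases p)
  case (Pair x z)
  then have "(z, x) \<in> farey_triangle" using assms farey_triangle_swap[of p] by simp
  then show ?thesis using assms by (simp add: Pair itinerary_hat_def itinerary_T_eq)
qed

text \<open>The backward sum runs over the iterates 1 to \<open>n + 1\<close> of the reversed orbit;
  the forward sum with \<open>n + 2\<close> terms also contains the iterate 0, which is
  subtracted.\<close>

lemma f_hat_neg_eq:
  assumes "(a, b) \<in> farey_triangle"
  shows "f_hat_neg (a, b) n = f_hat (b, a) (n + 2) - (itinerary_hat (b, a) - 3)"
proof -
  have hat: "itinerary_hat ((bcz_inv ^^ i) (a, b)) = itinerary_hat ((bcz ^^ i) (b, a))" for i
    using bcz_inv_funpow[OF assms, of i] itinerary_hat_swap by simp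
  show ?thesis
  proof (induction n)
    case 0
    have "f_hat (b, a) 2 = (itinerary_hat (b, a) - 3) + (itinerary_hat (bcz (b, a)) - 3)"
      by (simp add: f_hat_def numeral_2_eq_2)
    moreover have "f_hat_neg (a, b) 0 = itinerary_hat (bcz (b, a)) - 3"
      using hat[of 1] by (simp add: f_hat_neg_def)
    ultimately show ?case by (simp add: numeral_2_eq_2)
  next
    case (Suc n)
    have "f_hat (b, a) (Suc n + 2) = f_hat (b, a) (n + 2) + (itinerary_hat ((bcz ^^ (n + 2)) (b, a)) - 3)"
      unfolding f_hat_def by (simp del: funpow.simps)
    moreover have "f_hat_neg (a, b) (Suc n) = f_hat_neg (a, b) n + (itinerary_hat ((bcz_inv ^^ (n + 2)) (a, b)) - 3)"
      unfolding f_hat_neg_def by (simp del: funpow.simps)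
    ultimately show ?case using Suc hat[of "n + 2"] by (simp del: funpow.simps)
  qed
qed

lemma growth_exp_f_hat:
  assumes "(a, b) \<in> farey_triangle" "b / a \<notin> \<rat>"
  shows "growth_exp (f_hat (a, b)) =
    max (exp_frac 1 (dioph_exp_odd (b / a))) (exp_frac 2 (dioph_exp_even (b / a)))"
proof -
  interpret bcz_orbit a b by unfold_locales fact+
  show ?thesis using f_hat_grows growth_exp_eqI by metis
qed

lemma growth_exp_f_hat_neg:
  assumes "(a, b) \<in> farey_triangle" "b / a \<notin> \<rat>"
  shows "growth_exp (f_hat_neg (a, b)) =
    max (exp_frac 1 (dioph_exp_even (b / a))) (exp_frac 2 (dioph_exp_odd (b / a)))"
proof -
  have ab: "a > 0" "b > 0" using assms(1) by (auto simp: farey_triangle_def)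
  have inv: "b / a = 1 / (a / b)" "a / b = 1 / (b / a)" by simp_all
  have irr: "a / b \<notin> \<rat>"
    using assms(2) inv Rats_1 Rats_divide by metis
  interpret bcz_orbit b a
    by unfold_locales (use assms irr farey_triangle_swap[of "(a, b)"] in auto)
  have exps: "dioph_exp_even (b / a) = dioph_exp_odd (a / b)" "dioph_exp_even (a / b) = dioph_exp_odd (b / a)"
    using dioph_exp_even_inverse[of "a / b"] dioph_exp_even_inverse[of "b / a"] ab irr assms(2) by auto
  obtain \<theta> where \<theta>: "ereal \<theta> = max (exp_frac 1 (dioph_exp_odd (a / b))) (exp_frac 2 (dioph_exp_even (a / b)))"
    "\<theta> \<ge> 1 / 2" "grows (f_hat (b, a)) \<theta>" by (rule f_hat_grows)
  have "grows (f_hat_neg (a, b)) \<theta>"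
    by (rule grows_shift[OF \<theta>(3) _ f_hat_neg_eq[OF assms(1)]]) (use \<theta>(2) in simp)
  then show ?thesis using growth_exp_eqI \<theta>(1) exps by metis
qed

section \<open>Almost every point\<close>

text \<open>Borel--Cantelli: for denominator \<open>n\<close> the exceptional set consists of
  \<open>O(n)\<close> intervals of length \<open>2 / n powr v\<close>, and the measures are summable
  as \<open>v > 2\<close>.\<close>

lemma AE_eventually_badly_approximable:
  fixes v B :: real
  assumes v: "v > 2" and B: "B \<ge> 0"
  shows "AE s in lborel. \<forall>\<^sub>F n in sequentially. \<forall>p::int. \<bar>of_int p\<bar> \<le> B * real n \<longrightarrow>
    1 / real n powr v \<le> \<bar>s - of_int p / real n\<bar>"
proof -
  define I where "I n = {- \<lceil>B * real n\<rceil>..\<lceil>B * real n\<rceil>}" for n :: nat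
  define U where "U n p = {of_int p / real n - 1 / real n powr v<..<of_int p / real n + 1 / real n powr v}"
    for n :: nat and p :: int
  define A where "A n = (\<Union>p\<in>I n. U n p)" for n
  have meas: "A n \<in> sets lborel" for n
    unfolding A_def U_def by (intro sets.finite_UN) (auto simp: I_def)
  have I: "real (card (I n)) \<le> (2 * B + 3) * real n" if "n \<ge> 1" for n
  proof -
    have "B * real n \<ge> 0" using B by simp
    then have c: "0 \<le> \<lceil>B * real n\<rceil>" "\<lceil>B * real n\<rceil> \<le> B * real n + 1" by linarith+
    then have "real (card (I n)) = 2 * real_of_int \<lceil>B * real n\<rceil> + 1" by (simp add: I_def)
    then show ?thesis using c that by (simp add: algebra_simps)
  qed
  have U: "emeasure lborel (U n p) = ennreal (2 / real n powr v)" for n p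
    by (simp add: U_def)
  have emeas: "emeasure lborel (A n) \<le> ennreal ((4 * B + 6) * real n powr (1 - v))" if n: "n \<ge> 1" for n
  proof -
    have "emeasure lborel (A n) \<le> (\<Sum>p\<in>I n. emeasure lborel (U n p))"
      unfolding A_def by (intro emeasure_subadditive_finite) (auto simp: I_def U_def)
    also have "\<dots> = ennreal (real (card (I n)) * (2 / real n powr v))"
      by (simp add: U ennreal_of_nat_eq_real_of_nat ennreal_mult[symmetric])
    also have "\<dots> \<le> ennreal (((2 * B + 3) * real n) * (2 / real n powr v))"
      using I[OF n] by (intro ennreal_leI mult_right_mono) auto
    also have "((2 * B + 3) * real n) * (2 / real n powr v) = (4 * B + 6) * real n powr (1 - v)"
      using n by (simp add: powr_diff field_simps)
    finally show ?thesis .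
  qed
  \<comment> \<open>Division by 0 gives 0, so both end points of each interval coincide.\<close>
  have A0: "A 0 = {}" by (simp add: A_def U_def)
  have fin: "emeasure lborel (A n) < \<infinity>" for n
  proof (cases "n = 0")
    case False
    then show ?thesis using emeas[of n] by (auto simp: le_less_trans)
  qed (simp add: A0)
  have le: "measure lborel (A n) \<le> (4 * B + 6) * real n powr (1 - v)" for n
  proof (cases "n = 0")
    case False
    then show ?thesis
      using emeas[of n] B unfolding measure_def by (intro enn2real_leI) auto
  qed (simp add: A0)
  have "summable (\<lambda>n. (4 * B + 6) * real n powr (1 - v))"
    using v by (intro summable_mult) (simp add: summable_real_powr_iff)
  then have "summable (\<lambda>n. measure lborel (A n))"
  proof (rule summable_comparison_test'[where N = 0])
    show "norm (measure lborel (A n)) \<le> (4 * B + 6) * real n powr (1 - v)" for n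
      using le[of n] by (simp only: real_norm_def abs_of_nonneg[OF measure_nonneg])
  qed
  from borel_cantelli_AE1[OF meas fin this] show ?thesis
  proof (rule AE_mp, intro AE_I2 impI)
    fix s :: real
    assume "\<forall>\<^sub>F n in sequentially. s \<in> space lborel - A n"
    then show "\<forall>\<^sub>F n in sequentially. \<forall>p::int. \<bar>of_int p\<bar> \<le> B * real n \<longrightarrow>
      1 / real n powr v \<le> \<bar>s - of_int p / real n\<bar>"
    proof (eventually_elim, intro allI impI)
      fix n and p :: int
      assume s: "s \<in> space lborel - A n" and p: "\<bar>of_int p\<bar> \<le> B * real n"
      have "p \<in> I n" using p unfolding I_def by (auto simp: abs_le_iff) linarith+
      then have "s \<notin> U n p" using s by (auto simp: A_def)
      then show "1 / real n powr v \<le> \<bar>s - of_int p / real n\<bar>"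
        by (auto simp: U_def abs_if)
    qed
  qed
qed

lemma dioph_exp_odd_le: "dioph_exp_odd s \<le> dioph_exp s"
  unfolding dioph_exp_odd_def dioph_exp_def
  by (intro Sup_subset_mono) (auto elim!: infinite_super[rotated])

lemma dioph_exp_even_le: "dioph_exp_even s \<le> dioph_exp s"
  unfolding dioph_exp_even_def dioph_exp_def
  by (intro Sup_subset_mono) (auto elim!: infinite_super[rotated])

text \<open>Approximations within distance 1 have numerators at most
  \<open>(\<bar>s\<bar> + 1)\<close> times the denominator in absolute value, hence within the range
  controlled by \<open>B\<close>.\<close>

lemma dioph_exp_le:
  assumes v: "v \<ge> 0" and B: "B \<ge> \<bar>s\<bar> + 1"
    and ev: "\<forall>\<^sub>F n in sequentially. \<forall>p::int. \<bar>of_int p\<bar> \<le> B * real n \<longrightarrow>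
      1 / real n powr v \<le> \<bar>s - of_int p / real n\<bar>"
  shows "dioph_exp s \<le> ereal v"
  unfolding dioph_exp_def
proof (rule Sup_least, rule ccontr)
  fix x assume "x \<in> {ereal w | w. infinite {r. \<bar>s - of_rat r\<bar> < 1 / of_int (denom r) powr w}}"
    and "\<not> x \<le> ereal v"
  then obtain w where w: "infinite {r. \<bar>s - of_rat r\<bar> < 1 / of_int (denom r) powr w}" "w > v" by auto
  obtain N where N: "\<And>n (p::int). n \<ge> N \<Longrightarrow> \<bar>of_int p\<bar> \<le> B * real n \<Longrightarrow>
      1 / real n powr v \<le> \<bar>s - of_int p / real n\<bar>"
    using ev by (auto simp: eventually_sequentially)
  have dist: "\<bar>s - of_rat r\<bar> \<le> 1" if "\<bar>s - of_rat r\<bar> < 1 / of_int (denom r) powr w" for r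
    using that inverse_powr_denom_le_1[of w r] v w by simp
  have "infinite {r \<in> {r. \<bar>s - of_rat r\<bar> < 1 / of_int (denom r) powr w}. real_of_int (denom r) > N}"
    using w(1) by (rule infinite_imp_large_denom[where s = s]) (use dist in auto)
  then obtain r where r: "\<bar>s - of_rat r\<bar> < 1 / of_int (denom r) powr w" "real_of_int (denom r) > N"
    using not_finite_existsD by blast
  obtain P where P: "of_rat r = real_of_int P / denom r" by (rule of_rat_denom)
  define n where "n = nat (denom r)"
  have n: "real n = real_of_int (denom r)" "n \<ge> 1" "n \<ge> N" using denom_pos[of r] r(2) by (auto simp: n_def)
  have Pn: "of_rat r = of_int P / real n" using P n by simp
  have "\<bar>of_int P / real n\<bar> \<le> \<bar>s\<bar> + 1" using dist[OF r(1)] unfolding Pn by linarith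
  then have "\<bar>of_int P\<bar> \<le> (\<bar>s\<bar> + 1) * real n" using n by (simp add: field_simps)
  also have "\<dots> \<le> B * real n" using B by (intro mult_right_mono) auto
  finally have "1 / real n powr v \<le> \<bar>s - of_int P / real n\<bar>" using N n by blast
  moreover have "1 / real n powr w \<le> 1 / real n powr v"
    using n w by (intro divide_left_mono powr_mono) auto
  ultimately show False using r(1) n(1) Pn by simp
qed

text \<open>Countably many exponents decreasing to 2 and integer bounds \<open>B\<close> suffice, so
  the exceptional sets unite to a null set.\<close>

lemma AE_dioph_exp_le_2: "AE s in lborel. dioph_exp s \<le> 2"
proof -
  have "AE s in lborel. \<forall>k B :: nat. \<forall>\<^sub>F n in sequentially. \<forall>p::int. \<bar>of_int p\<bar> \<le> real B * real n \<longrightarrow>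
    1 / real n powr (2 + 1 / Suc k) \<le> \<bar>s - of_int p / real n\<bar>"
    unfolding AE_all_countable by (intro allI AE_eventually_badly_approximable) auto
  then show ?thesis
  proof (rule AE_mp, intro AE_I2 impI)
    fix s :: real
    assume s: "\<forall>k B :: nat. \<forall>\<^sub>F n in sequentially. \<forall>p::int. \<bar>of_int p\<bar> \<le> real B * real n \<longrightarrow>
      1 / real n powr (2 + 1 / Suc k) \<le> \<bar>s - of_int p / real n\<bar>"
    obtain B :: nat where B: "real B \<ge> \<bar>s\<bar> + 1" using real_arch_simple by blast
    have le: "dioph_exp s \<le> ereal (2 + 1 / Suc k)" for k
      by (rule dioph_exp_le[OF _ B]) (use s in auto)
    have "(\<lambda>k. ereal (2 + 1 / Suc k)) \<longlonglongrightarrow> ereal 2"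
      by (intro tendsto_ereal) real_asymp
    then have "dioph_exp s \<le> ereal 2"
      by (rule LIMSEQ_le_const) (use le in auto)
    then show "dioph_exp s \<le> 2" by simp
  qed
qed

text \<open>By Fubini: for fixed \<open>x > 0\<close> the exceptional \<open>y\<close> form a dilate
  of a null set, enlarged beforehand to a measurable one.\<close>

lemma AE_quotient:
  assumes "AE s in lborel. P s"
  shows "AE z in (lborel :: (real \<times> real) measure). fst z > 0 \<longrightarrow> P (snd z / fst z)"
proof -
  obtain N where N: "{s \<in> space lborel. \<not> P s} \<subseteq> N" "emeasure lborel N = 0" "N \<in> sets lborel"
    using AE_E[OF assms] by blast
  have [measurable]: "N \<in> sets borel" using N by simp
  have "AE s in lborel. s \<notin> N" using N by (intro AE_not_in) auto
  then have slice: "AE y in lborel. y / x \<notin> N" if "x > 0" for x :: real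
    using AE_borel_affine[of "1 / x" "\<lambda>s. s \<notin> N" 0] that by simp
  have "AE z in (lborel \<Otimes>\<^sub>M lborel). fst z > 0 \<longrightarrow> snd z / fst z \<notin> N"
  proof (rule lborel_pair.AE_pair_measure)
    show "{z \<in> space (lborel \<Otimes>\<^sub>M lborel). 0 < fst z \<longrightarrow> snd z / fst z \<notin> N} \<in> sets (lborel \<Otimes>\<^sub>M (lborel :: real measure))"
      by measurable
    show "AE x in lborel. AE y in lborel. 0 < fst (x, y) \<longrightarrow> snd (x, y) / fst (x, y) \<notin> N"
    proof (rule AE_I2)
      show "AE y in lborel. 0 < fst (x, y) \<longrightarrow> snd (x, y) / fst (x, y) \<notin> N" for x :: real
        using slice[of x] by (cases "x > 0") auto
    qed
  qed
  then show ?thesis unfolding lborel_prod by (rule AE_mp) (use N(1) in auto)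
qed

theorem corollary1p6:
  shows "(\<forall>a b :: real. (a, b) \<in> farey_triangle \<longrightarrow> b / a \<notin> \<rat> \<longrightarrow>
      growth_exp (f_hat (a, b)) =
        max (exp_frac 1 (dioph_exp_odd (b / a))) (exp_frac 2 (dioph_exp_even (b / a))))
    \<and> (\<forall>a b :: real. (a, b) \<in> farey_triangle \<longrightarrow> b / a \<notin> \<rat> \<longrightarrow>
      growth_exp (f_hat_neg (a, b)) =
        max (exp_frac 1 (dioph_exp_even (b / a))) (exp_frac 2 (dioph_exp_odd (b / a))))
    \<and> (AE (a, b) in (lborel :: (real \<times> real) measure).
      (a, b) \<in> farey_triangle \<longrightarrow> b / a \<notin> \<rat> \<longrightarrow>
        dioph_exp (b / a) = 2 \<and> dioph_exp_even (b / a) = 2 \<and> dioph_exp_odd (b / a) = 2 \<and>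
        growth_exp (f_hat (a, b)) = 1 / 2 \<and> growth_exp (f_hat_neg (a, b)) = 1 / 2)"
proof (intro conjI allI impI)
  show "AE (a, b) in (lborel :: (real \<times> real) measure).
      (a, b) \<in> farey_triangle \<longrightarrow> b / a \<notin> \<rat> \<longrightarrow>
        dioph_exp (b / a) = 2 \<and> dioph_exp_even (b / a) = 2 \<and> dioph_exp_odd (b / a) = 2 \<and>
        growth_exp (f_hat (a, b)) = 1 / 2 \<and> growth_exp (f_hat_neg (a, b)) = 1 / 2"
    using AE_quotient[OF AE_dioph_exp_le_2]
  proof (rule AE_mp, intro AE_I2 impI, clarify)
    fix a b :: real
    assume le: "0 < fst (a, b) \<longrightarrow> dioph_exp (snd (a, b) / fst (a, b)) \<le> 2"
      and ab: "(a, b) \<in> farey_triangle" and irr: "b / a \<notin> \<rat>"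
    have le: "dioph_exp (b / a) \<le> 2" using le ab by (simp add: farey_triangle_def)
    have e: "dioph_exp_odd (b / a) = 2" "dioph_exp_even (b / a) = 2"
      using order_trans[OF dioph_exp_odd_le le] order_trans[OF dioph_exp_even_le le]
        dioph_exp_odd_ge_2[OF irr] dioph_exp_even_ge_2[OF irr] by (auto intro: antisym)
    have "dioph_exp (b / a) = 2" using le dioph_exp_odd_le[of "b / a"] e by (auto intro: antisym)
    moreover have "max (exp_frac 1 2) (exp_frac 2 2) = 1 / (2 :: ereal)"
      using exp_frac_ereal[of 2 1] exp_frac_ereal[of 2 2] by (simp add: one_ereal_def max_def)
    ultimately show "dioph_exp (b / a) = 2 \<and> dioph_exp_even (b / a) = 2 \<and> dioph_exp_odd (b / a) = 2 \<and>
        growth_exp (f_hat (a, b)) = 1 / 2 \<and> growth_exp (f_hat_neg (a, b)) = 1 / 2"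
      using growth_exp_f_hat[OF ab irr] growth_exp_f_hat_neg[OF ab irr] by (simp only: e)
  qed
qed (use growth_exp_f_hat growth_exp_f_hat_neg in blast)+

end
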